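(* For every integer $n\geq 1$, the algorithm $\mathrm{EnumBPiso}$ (described in the context) on input $n$ enumerates $\mathsf{BP}_n^\star$: identifying each output with the partitioned order it represents, all outputs belong to $\mathsf{BP}_n$, and for every equivalence class of $\equiv_\star$ on $\mathsf{BP}_n$ exactly one output (counted with multiplicity) belongs to that class.
   Context: Notation: $\llbracket n\rrbracket=\{0,\dots,n-1\}$. A partitioned order of $\llbracket n\rrbracket$ is an (unordered) set $\{S_k\}_{k\in\llbracket s\rrbracket}$ of $s$ sequences $S_k=(i^k_0,\dots,i^k_{n_k-1})$ with $n_k>0$, each consisting of pairwise distinct elements of $\llbracket n\rrbracket$, the sequences being pairwise disjoint (as sets of entries) with union $\llbracket n\rrbracket$. The sequences are called o-blocks. $\mathsf{BP}_n$ is the set of all partitioned orders of $\llbracket n\rrbracket$ (block-parallel update modes of size $n$). For $\mu=\{S_k\}_{k\in\llbracket s\rrbracket}\in\mathsf{BP}_n$, let $p=\mathrm{lcm}(n_0,\dots,n_{s-1})$ and define the sequence of blocks $\varphi(\mu)=(W_\ell)_{\ell\in\llbracket p\rrbracket}$ by $W_\ell=\{i^k_{\ell \bmod n_k}\mid k\in\llbracket s\rrbracket\}$; write $|\varphi(\mu)|=p$. $\sigma^i$ denotes the circular shift of order $i\in\mathbb{Z}$ on finite sequences, moving the element at position $0$ to position $i$ (positions modulo the length). For $\mu,\mu'\in\mathsf{BP}_n$, $\mu\equiv_\star\mu'$ means $\varphi(\mu)=\sigma^i(\varphi(\mu'))$ for some $i\in\llbracket|\varphi(\mu')|\rrbracket$;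 $\mathsf{BP}_n^\star=\mathsf{BP}_n/\equiv_\star$. Integer partitions: the integer partitions of $n$ are listed in some fixed order; $d(i)$ is the maximal part size of the $i$-th partition, and $m(i,j)$ is the multiplicity of the part of size $j$ in it (possibly $0$). Matrix representation: a list $M=(M_1,\dots,M_{d(i)})$, where $M_j$ is a matrix with $m(i,j)$ rows and $j$ columns (empty if $m(i,j)=0$) such that each element of $\llbracket n\rrbracket$ is an entry exactly once overall, represents the partitioned order whose o-blocks are all the rows of all the matrices (each row read from left to right). Algorithm $\mathrm{EnumBPiso}(n)$: for each partition $i$ of $n$: set $b\leftarrow 1$; for $j$ going down from $d(i)$ to $1$: if $m(i,j)>0$, set $a[j]\leftarrow\gcd(b,j)$ and then $b\leftarrow\mathrm{lcm}(b,j)$; otherwise set $a[j]\leftarrow j$. Then call $\mathrm{Aux}(n,i,1,a)$. $\mathrm{Aux}(n,i,j,a,M_1,\dots,M_{j-1})$: (1) If $d(i)<j$, output $M=(M_1,\dots,M_{j-1})$ and return. (2) Otherwise, if $m(i,j)>0$: for each subset $A$ of size $j\cdot m(i,j)$ of the elements of $\llbracket n\rrbracket$ not occurring in $M_1,\dots,M_{j-1}$, let $\min_j=\min(A)$, and for each matrix $M_j$ enumerated by $\mathrm{Block}(A,j,m(i,j),\min_j,a[j])$, call $\mathrm{Aux}(n,i,j+1,a,M_1,\dots,M_{j-1},M_j)$. (3) Otherwise ($m(i,j)=0$), call $\mathrm{Aux}(n,i,j+1,a,M_1,\dots,M_{j-1},\emptyset)$. $\mathrm{Block}(A,j,m,\min_j,a_j)$: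 for each list of columns $C=(C_1,\dots,C_j)$ enumerated by $\mathrm{BlockAux}(A,j,m,\min_j,a_j)$, enumerate the matrix $M_j$ with $M_j[k][\ell]=C_\ell[k]$ for $1\le k\le m$, $1\le\ell\le j$, where the elements of each set $C_\ell$ are listed in some fixed order (e.g. increasing) as $C_\ell[1],\dots,C_\ell[m]$. $\mathrm{BlockAux}(A,j,m,\min_j,a_j,C_1,\dots,C_\ell)$: (i) If $A=\emptyset$, enumerate $(C_1,\dots,C_\ell)$ and return. (ii) Otherwise, if $|A|=m\cdot(j-a_j+1)$ and $\min_j\in A$: for each subset $B\subseteq A\setminus\{\min_j\}$ of size $m-1$, call $\mathrm{BlockAux}(A\setminus(B\cup\{\min_j\}),j,m,\min_j,a_j,C_1,\dots,C_\ell,B\cup\{\min_j\})$. (iii) Otherwise, for each subset $B\subseteq A$ of size $m$, call $\mathrm{BlockAux}(A\setminus B,j,m,\min_j,a_j,C_1,\dots,C_\ell,B)$. *)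

theory Defs
  imports Complex_Main "HOL-Library.Multiset"
begin

definition BP :: "nat \<Rightarrow> nat list set set" where
  "BP n = {\<mu>. (\<forall>S\<in>\<mu>. S \<noteq> [] \<and> distinct S) \<and>
             (\<forall>S\<in>\<mu>. \<forall>T\<in>\<mu>. S \<noteq> T \<longrightarrow> set S \<inter> set T = {}) \<and>
             (\<Union>S\<in>\<mu>. set S) = {..<n}}"

definition blocks :: "nat list set \<Rightarrow> nat set list" where
  "blocks \<mu> = map (\<lambda>l. {S ! (l mod length S) |S. S \<in> \<mu>}) [0..<Lcm (length ` \<mu>)]"

text \<open>The entry at position \<open>0\<close> moves to position \<open>i\<close> modulo the length, so this shifts to the
  right for positive \<open>i\<close>, contrary to \<^const>\<open>rotate\<close>.\<close>

definition cshift :: "int \<Rightarrow> 'a list \<Rightarrow> 'a list" where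
  "cshift i xs = map (\<lambda>l. xs ! nat ((int l - i) mod int (length xs))) [0..<length xs]"

definition BP_iso :: "nat \<Rightarrow> (nat list set \<times> nat list set) set" where
  "BP_iso n = {(\<mu>, \<mu>'). \<mu> \<in> BP n \<and> \<mu>' \<in> BP n \<and>
     (\<exists>i<length (blocks \<mu>'). blocks \<mu> = cshift (int i) (blocks \<mu>'))}"

definition BP_star :: "nat \<Rightarrow> nat list set set set" where
  "BP_star n = BP n // BP_iso n"

text \<open>A partition of \<open>n\<close> is the multiset of its parts; the multiplicity \<open>m(i,j)\<close> of the part \<open>j\<close>
  is \<open>count i j\<close>.\<close>

definition int_partitions :: "nat \<Rightarrow> nat multiset set" where
  "int_partitions n = {i. (\<forall>j\<in>#i. 0 < j) \<and> sum_mset i = n}"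

definition max_part :: "nat multiset \<Rightarrow> nat" where
  "max_part i = Max (set_mset i)"

text \<open>A matrix is the list of its rows. In a list \<open>Ms\<close> of matrices, \<open>M\<^sub>j\<close> is \<open>Ms ! (j - 1)\<close>.\<close>

type_synonym matrix = "nat list list"

definition entries :: "matrix list \<Rightarrow> nat list" where
  "entries Ms = concat (concat Ms)"

definition matrix_rep :: "nat \<Rightarrow> nat multiset \<Rightarrow> matrix list \<Rightarrow> bool" where
  "matrix_rep n i Ms \<longleftrightarrow>
     length Ms = max_part i \<and>
     (\<forall>j\<in>{1..max_part i}. length (Ms ! (j - 1)) = count i j \<and>
                          (\<forall>row\<in>set (Ms ! (j - 1)). length row = j)) \<and>
     distinct (entries Ms) \<and> set (entries Ms) = {..<n}"

definition represented :: "matrix list \<Rightarrow> nat list set" where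
  "represented Ms = set (concat Ms)"

text \<open>An enumeration is the multiset of its outputs, and a loop ``for each \<open>x\<close> in \<open>X\<close>'' is the
  multiset sum over \<open>X\<close>; the order of the iterations is irrelevant to the multiset.
  All sets summed over are finite (otherwise the sum would be empty by convention).

  In \<open>block_aux\<close> the case of an infinite \<open>A\<close> or \<open>m = 0\<close> only serves to make the recursion
  terminate; the algorithm calls it with finite \<open>A\<close> and positive \<open>m\<close> only.
  The subtraction \<open>j - a\<close> does not truncate there, since then \<open>a\<close> divides \<open>j\<close>.\<close>

function block_aux :: "nat set \<Rightarrow> nat \<Rightarrow> nat \<Rightarrow> nat \<Rightarrow> nat \<Rightarrow> nat set list \<Rightarrow> nat set list multiset" where
  "block_aux A j m mn a Cs =
    (if A = {} then {#Cs#}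
     else if infinite A \<or> m = 0 then {#}
     else if card A = m * (j - a + 1) \<and> mn \<in> A then
       (\<Sum>B\<in>{B. B \<subseteq> A - {mn} \<and> card B = m - 1}.
          block_aux (A - (B \<union> {mn})) j m mn a (Cs @ [B \<union> {mn}]))
     else
       (\<Sum>B\<in>{B. B \<subseteq> A \<and> card B = m}. block_aux (A - B) j m mn a (Cs @ [B])))"
  by pat_completeness auto
termination
proof (relation "measure (\<lambda>(A, _). card A)", goal_cases)
  case 1
  show ?case by simp
next
  case (2 A j m mn a Cs B)
  then have "A - (B \<union> {mn}) \<subset> A" "finite A" by auto
  then show ?case by (simp add: psubset_card_mono)
next
  case (3 A j m mn a Cs B)
  then have "B \<noteq> {}" "B \<subseteq> A" by auto
  then have "A - B \<subset> A" "finite A" using 3 by auto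
  then show ?case by (simp add: psubset_card_mono)
qed

declare block_aux.simps [simp del]

text \<open>\<open>lst\<close> is the fixed order in which the elements of each set are listed.\<close>

definition block ::
  "(nat set \<Rightarrow> nat list) \<Rightarrow> nat set \<Rightarrow> nat \<Rightarrow> nat \<Rightarrow> nat \<Rightarrow> nat \<Rightarrow> matrix multiset" where
  "block lst A j m mn a =
     image_mset (\<lambda>Cs. map (\<lambda>k. map (\<lambda>C. lst C ! k) Cs) [0..<m]) (block_aux A j m mn a [])"

function aux ::
  "(nat set \<Rightarrow> nat list) \<Rightarrow> nat \<Rightarrow> nat multiset \<Rightarrow> nat \<Rightarrow> (nat \<Rightarrow> nat) \<Rightarrow> matrix list \<Rightarrow>
     matrix list multiset" where
  "aux lst n i j a Ms =
    (if max_part i < j then {#Ms#}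
     else if count i j > 0 then
       (\<Sum>A\<in>{A. A \<subseteq> {..<n} - set (entries Ms) \<and> card A = j * count i j}.
          \<Sum>M\<in>#block lst A j (count i j) (Min A) (a j). aux lst n i (j + 1) a (Ms @ [M]))
     else aux lst n i (j + 1) a (Ms @ [[]]))"
  by pat_completeness auto
termination
  by (relation "measure (\<lambda>(_, _, i, j, _). Suc (max_part i) - j)") auto

declare aux.simps [simp del]

definition gcd_step :: "nat multiset \<Rightarrow> nat \<Rightarrow> nat \<times> (nat \<Rightarrow> nat) \<Rightarrow> nat \<times> (nat \<Rightarrow> nat)" where
  "gcd_step i j = (\<lambda>(b, a). if count i j > 0 then (lcm b j, a(j := gcd b j)) else (b, a(j := j)))"

text \<open>The initial content of the array \<open>a\<close> is immaterial.\<close>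

definition gcd_table :: "nat multiset \<Rightarrow> nat \<Rightarrow> nat" where
  "gcd_table i = snd (fold (gcd_step i) (rev [1..<max_part i + 1]) (1, \<lambda>_. 0))"

definition EnumBPiso :: "(nat set \<Rightarrow> nat list) \<Rightarrow> nat \<Rightarrow> matrix list multiset" where
  "EnumBPiso lst n = (\<Sum>i\<in>int_partitions n. aux lst n i 1 (gcd_table i) [])"

lemma finite_int_partitions: "finite (int_partitions n)"
proof (rule finite_subset)
  show "int_partitions n \<subseteq> mset ` {xs. set xs \<subseteq> {..n} \<and> length xs \<le> n}"
  proof
    fix i assume i: "i \<in> int_partitions n"
    obtain xs where xs: "i = mset xs" by (metis ex_mset)
    have pos: "\<forall>x\<in>set xs. 0 < x" and sum: "sum_list xs = n"
      using i by (auto simp: int_partitions_def xs sum_mset_sum_list)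
    have "\<forall>x\<in>set xs. 0 < x \<Longrightarrow> length xs \<le> sum_list xs" by (induction xs) auto
    moreover have "\<forall>x\<in>set xs. x \<le> n" using sum member_le_sum_list by blast
    ultimately show "i \<in> mset ` {xs. set xs \<subseteq> {..n} \<and> length xs \<le> n}"
      using pos sum xs by auto
  qed
  show "finite (mset ` {xs. set xs \<subseteq> {..n} \<and> length xs \<le> n})"
    by (simp add: finite_lists_length_le)
qed

lemma length_cshift [simp]: "length (cshift i xs) = length xs"
  by (simp add: cshift_def)

lemma nth_cshift:
  "l < length xs \<Longrightarrow> cshift i xs ! l = xs ! nat ((int l - i) mod int (length xs))"
  by (simp add: cshift_def)

lemma cshift_cshift: "cshift i (cshift j xs) = cshift (i + j) xs"
proof (rule nth_equalityI)
  fix l assume "l < length (cshift i (cshift j xs))"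
  then have l: "l < length xs" by simp
  let ?k = "(int l - i) mod int (length xs)"
  from l have p: "0 < int (length xs)" by linarith
  then have k: "0 \<le> ?k" "nat ?k < length xs"
    using pos_mod_bound[OF p, of "int l - i"] by (simp, subst nat_less_iff) auto
  have "cshift i (cshift j xs) ! l = xs ! nat ((?k - j) mod int (length xs))"
    using l k by (simp add: nth_cshift)
  also have "(?k - j) mod int (length xs) = (int l - (i + j)) mod int (length xs)"
    by (simp add: mod_diff_left_eq algebra_simps)
  finally show "cshift i (cshift j xs) ! l = cshift (i + j) xs ! l"
    using l by (simp add: nth_cshift)
qed simp

lemma cshift_0: "cshift 0 xs = xs"
  by (rule nth_equalityI) (simp_all add: nth_cshift)

lemma cshift_mod: "cshift (i mod int (length xs)) xs = cshift i xs"
  by (rule nth_equalityI) (simp_all add: nth_cshift mod_diff_right_eq)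

lemma length_blocks_pos:
  assumes "\<mu> \<in> BP n"
  shows "0 < length (blocks \<mu>)"
proof -
  have "\<mu> \<subseteq> {xs. set xs \<subseteq> {..<n} \<and> length xs \<le> n}"
  proof
    fix S assume S: "S \<in> \<mu>"
    then have *: "set S \<subseteq> {..<n}" "distinct S" using assms by (auto simp: BP_def)
    then have "length S \<le> n"
      by (metis card_lessThan card_mono distinct_card finite_lessThan)
    with * show "S \<in> {xs. set xs \<subseteq> {..<n} \<and> length xs \<le> n}" by simp
  qed
  then have "finite \<mu>" by (rule finite_subset) (simp add: finite_lists_length_le)
  moreover have "0 \<notin> length ` \<mu>" using assms by (auto simp: BP_def)
  ultimately have "Lcm (length ` \<mu>) \<noteq> 0" by (simp add: Lcm_0_iff)
  then show ?thesis by (simp add: blocks_def)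
qed

lemma equiv_BP_iso: "equiv (BP n) (BP_iso n)"
proof (rule equivI)
  have red: "(\<mu>, \<mu>') \<in> BP_iso n"
    if "\<mu> \<in> BP n" "\<mu>' \<in> BP n" "blocks \<mu> = cshift i (blocks \<mu>')" for \<mu> \<mu>' i
  proof -
    let ?p = "length (blocks \<mu>')"
    have p: "0 < ?p" using length_blocks_pos that by blast
    have "nat (i mod int ?p) < ?p"
      using p pos_mod_bound[of "int ?p" i] by (subst nat_less_iff) auto
    moreover have "blocks \<mu> = cshift (int (nat (i mod int ?p))) (blocks \<mu>')"
      using p that(3) by (simp add: cshift_mod)
    ultimately show ?thesis using that by (auto simp: BP_iso_def)
  qed
  show "BP_iso n \<subseteq> BP n \<times> BP n" by (auto simp: BP_iso_def)
  show "refl_on (BP n) (BP_iso n)"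
    by (rule refl_onI) (auto intro: red[where i = 0] simp: cshift_0)
  show "sym (BP_iso n)"
  proof (rule symI)
    fix \<mu> \<mu>' assume "(\<mu>, \<mu>') \<in> BP_iso n"
    then obtain i where "\<mu> \<in> BP n" "\<mu>' \<in> BP n" "blocks \<mu> = cshift (int i) (blocks \<mu>')"
      by (auto simp: BP_iso_def)
    then show "(\<mu>', \<mu>) \<in> BP_iso n"
      by (intro red[where i = "- int i"]) (simp_all add: cshift_cshift cshift_0)
  qed
  show "trans (BP_iso n)"
  proof (rule transI)
    fix \<mu>1 \<mu>2 \<mu>3 assume "(\<mu>1, \<mu>2) \<in> BP_iso n" "(\<mu>2, \<mu>3) \<in> BP_iso n"
    then obtain i k where "\<mu>1 \<in> BP n" "\<mu>3 \<in> BP n"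
      "blocks \<mu>1 = cshift (int i) (blocks \<mu>2)" "blocks \<mu>2 = cshift (int k) (blocks \<mu>3)"
      by (auto simp: BP_iso_def)
    then show "(\<mu>1, \<mu>3) \<in> BP_iso n"
      by (intro red[where i = "int i + int k"]) (simp_all add: cshift_cshift)
  qed
qed

end

theory Submission
  imports Defs "HOL-Number_Theory.Cong" "HOL-Library.Disjoint_Sets"
begin

text \<open>A partitioned order is determined by the size \<open>sz x\<close> of the o-block of each element \<open>x\<close> and the
  position \<open>ps x\<close> of \<open>x\<close> in it, and both can be read off the sequence of blocks: \<open>x\<close> lies in
  \<open>W\<^sub>t\<close> iff \<open>t mod sz x = ps x\<close>. Hence equivalent partitioned orders are those with the same sizes
  whose positions differ by a common shift \<open>s\<close>, taken modulo \<open>sz x\<close>. Process the part sizes \<open>j\<close> in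
  decreasing order: the shifts that fix all positions for sizes above \<open>j\<close> are the multiples of the
  least common multiple \<open>L\<close> of these sizes, and they move the least element of the o-blocks of size
  \<open>j\<close> through a coset of the subgroup generated by \<open>gcd L j\<close>. So every class has exactly one member
  in which this position is below \<open>gcd L j\<close> for every \<open>j\<close>, and these are the outputs.\<close>

section \<open>Enumerations without repetition\<close>

text \<open>Equality with \<open>mset_set S\<close> gives every output multiplicity one. Finiteness
  is included because \<open>mset_set\<close> of an infinite set is empty by convention.\<close>

definition enumerates :: "'a multiset \<Rightarrow> 'a set \<Rightarrow> bool" where
  "enumerates M S \<longleftrightarrow> finite S \<and> M = mset_set S"

lemma enumerates_image:
  "enumerates M S \<Longrightarrow> inj_on f S \<Longrightarrow> enumerates (image_mset f M) (f ` S)"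
  by (simp add: enumerates_def image_mset_mset_set)

lemma enumerates_UN:
  assumes "finite X" "\<And>x. x \<in> X \<Longrightarrow> enumerates (f x) (S x)" "disjoint_family_on S X"
  shows "enumerates (\<Sum>x\<in>X. f x) (\<Union>x\<in>X. S x)"
  using assms
proof (induction X)
  case (insert x X)
  have "S x \<inter> (\<Union>y\<in>X. S y) = {}"
    using insert.hyps insert.prems(2) by (fastforce simp: disjoint_family_on_def)
  moreover have "enumerates (sum f X) (\<Union>y\<in>X. S y)"
    using insert by (auto simp: disjoint_family_on_def)
  ultimately show ?case
    using insert.hyps insert.prems(1) by (simp add: enumerates_def mset_set_Union)
qed (simp add: enumerates_def)

text \<open>Serves the loop over the matrices of a block. The passes are indexed by column lists
  \<open>x\<close>, and injectivity of \<open>f\<close>, which turns \<open>x\<close> into a matrix,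
  keeps different indices from sharing a pass.\<close>

lemma enumerates_sum_mset:
  assumes M: "enumerates M (f ` S)" and inj: "inj_on f S"
    and g: "\<And>x. x \<in> S \<Longrightarrow> enumerates (g (f x)) (T x)" and T: "disjoint_family_on T S"
  shows "enumerates (\<Sum>y\<in>#M. g y) (\<Union>x\<in>S. T x)"
proof -
  have fin: "finite S" using M inj by (auto simp: enumerates_def finite_image_iff)
  have "(\<Sum>y\<in>#M. g y) = (\<Sum>y\<in>f ` S. g y)"
    using M by (simp only: enumerates_def sum_unfold_sum_mset)
  also have "\<dots> = (\<Sum>x\<in>S. g (f x))"
    by (simp add: sum.reindex[OF inj])
  finally have "(\<Sum>y\<in>#M. g y) = (\<Sum>x\<in>S. g (f x))" .
  then show ?thesis using enumerates_UN[OF fin g T] by simp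
qed

section \<open>The subset loops\<close>

abbreviation disjoint_list :: "'a set list \<Rightarrow> bool" where
  "disjoint_list \<equiv> sorted_wrt (\<lambda>C D. C \<inter> D = {})"

lemma card_Union_disjoint_list:
  assumes "\<forall>C\<in>set Cs. finite C \<and> card C = m" "disjoint_list Cs"
  shows "card (\<Union>(set Cs)) = m * length Cs"
  using assms
proof (induction Cs)
  case (Cons C Cs)
  then have "C \<inter> \<Union>(set Cs) = {}" by auto
  then show ?case using Cons by (simp add: card_Un_disjoint)
qed simp

text \<open>At a call with \<open>r\<close> columns still to be chosen, \<open>mn\<close> is forced into the next column when \<open>r = q\<close>;
  hence it never lies in the last \<open>q - 1\<close> columns, unless fewer than \<open>q\<close> remain at the start.\<close>

definition column_lists :: "nat set \<Rightarrow> nat \<Rightarrow> nat \<Rightarrow> nat \<Rightarrow> nat set list set" where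
  "column_lists A m mn q =
     {Cs. (\<forall>C\<in>set Cs. finite C \<and> card C = m) \<and> disjoint_list Cs \<and> \<Union>(set Cs) = A \<and>
          (\<forall>l<length Cs. mn \<in> Cs ! l \<longrightarrow> q \<le> length Cs \<longrightarrow> l + q \<le> length Cs)}"

lemma column_lists_empty: "0 < m \<Longrightarrow> column_lists {} m mn q = {[]}"
proof -
  assume m: "0 < m"
  have "Cs = []" if "Cs \<in> column_lists {} m mn q" for Cs
  proof (rule ccontr)
    assume "Cs \<noteq> []"
    then obtain C Cs' where "Cs = C # Cs'" by (cases Cs) auto
    then show False using that m by (auto simp: column_lists_def)
  qed
  then show ?thesis by (auto simp: column_lists_def)
qed

text \<open>This is one step of the recursion. If exactly \<open>q\<close> columns remain, the
  position bound admits \<open>mn\<close> only in the first one, and for the tail, being shorter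
  than \<open>q\<close>, the bound is vacuous. Otherwise passing to the tail merely lowers positions
  and length by one.\<close>

lemma column_lists_Cons:
  assumes "finite A" "0 < m"
  shows "B # Cs \<in> column_lists A m mn q \<longleftrightarrow>
    B \<subseteq> A \<and> card B = m \<and> (card A = m * q \<and> mn \<in> A \<longrightarrow> mn \<in> B) \<and> Cs \<in> column_lists (A - B) m mn q"
    (is "?L \<longleftrightarrow> ?R")
proof -
  let ?D = "(\<forall>C\<in>set (B # Cs). finite C \<and> card C = m) \<and> disjoint_list (B # Cs) \<and> \<Union>(set (B # Cs)) = A"
  have D: "?D \<longleftrightarrow> B \<subseteq> A \<and> card B = m \<and> (\<forall>C\<in>set Cs. finite C \<and> card C = m) \<and>
      disjoint_list Cs \<and> \<Union>(set Cs) = A - B"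
    using finite_subset[OF _ assms(1), of B] by auto
  have "(\<forall>l<length (B # Cs). mn \<in> (B # Cs) ! l \<longrightarrow> q \<le> length (B # Cs) \<longrightarrow> l + q \<le> length (B # Cs))
    \<longleftrightarrow> (card A = m * q \<and> mn \<in> A \<longrightarrow> mn \<in> B) \<and>
        (\<forall>l<length Cs. mn \<in> Cs ! l \<longrightarrow> q \<le> length Cs \<longrightarrow> l + q \<le> length Cs)" (is "?l \<longleftrightarrow> ?r") if ?D
  proof -
    \<comment> \<open>All columns have \<open>m\<close> elements and together fill \<open>A\<close>,
      so the test on \<open>card A\<close> counts the columns still to come, \<open>B\<close>
      included.\<close>
    have "card A = m * length (B # Cs)"
      using card_Union_disjoint_list[of "B # Cs" m] that by auto
    then have cA: "card A = m * q \<longleftrightarrow> q = Suc (length Cs)"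
      using assms(2) by (metis length_Cons mult_cancel1 not_gr_zero)
    have A: "mn \<in> A \<longleftrightarrow> mn \<in> B \<or> (\<exists>l<length Cs. mn \<in> Cs ! l)"
    proof -
      have "mn \<in> \<Union>(set Cs) \<longleftrightarrow> (\<exists>l<length Cs. mn \<in> Cs ! l)"
        by (metis UnionE UnionI in_set_conv_nth)
      then show ?thesis using that by auto
    qed
    have dj: "mn \<notin> Cs ! l" if "mn \<in> B" "l < length Cs" for l
      using \<open>?D\<close> that nth_mem[OF that(2)] by auto
    \<comment> \<open>At position 0 the bound coincides with its premise that the list has at least
      \<open>q\<close> columns.\<close>
    have "?l \<longleftrightarrow> (\<forall>l<length Cs. mn \<in> Cs ! l \<longrightarrow> q \<le> Suc (length Cs) \<longrightarrow> l + q \<le> length Cs)"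
      by (auto simp: All_less_Suc2)
    also have "\<dots> \<longleftrightarrow> ?r" unfolding cA A
    proof (cases "q = Suc (length Cs)")
      case True
      then show "(\<forall>l<length Cs. mn \<in> Cs ! l \<longrightarrow> q \<le> Suc (length Cs) \<longrightarrow> l + q \<le> length Cs) \<longleftrightarrow>
        (q = Suc (length Cs) \<and> (mn \<in> B \<or> (\<exists>l<length Cs. mn \<in> Cs ! l)) \<longrightarrow> mn \<in> B) \<and>
        (\<forall>l<length Cs. mn \<in> Cs ! l \<longrightarrow> q \<le> length Cs \<longrightarrow> l + q \<le> length Cs)"
        using dj by auto
    next
      case False
      then have "q \<le> Suc (length Cs) \<longleftrightarrow> q \<le> length Cs" by auto
      then show "(\<forall>l<length Cs. mn \<in> Cs ! l \<longrightarrow> q \<le> Suc (length Cs) \<longrightarrow> l + q \<le> length Cs) \<longleftrightarrow>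
        (q = Suc (length Cs) \<and> (mn \<in> B \<or> (\<exists>l<length Cs. mn \<in> Cs ! l)) \<longrightarrow> mn \<in> B) \<and>
        (\<forall>l<length Cs. mn \<in> Cs ! l \<longrightarrow> q \<le> length Cs \<longrightarrow> l + q \<le> length Cs)"
        using False by simp
    qed
    finally show ?thesis .
  qed
  then have "?D \<and> ?l \<longleftrightarrow> ?D \<and> ?r" by (rule conj_cong[OF refl])
  moreover have "?L \<longleftrightarrow> ?D \<and> ?l"
    by (simp only: column_lists_def mem_Collect_eq conj_assoc)
  moreover have "?D \<and> ?r \<longleftrightarrow> ?R"
    unfolding D unfolding column_lists_def mem_Collect_eq by argo
  ultimately show ?thesis by (simp only:)
qed

text \<open>\<open>Cs\<close> is the accumulator, so every output is \<open>Cs\<close> followed by a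
  column list of the remaining set. Outputs for different choices of the next column differ at
  position \<open>length Cs\<close>.\<close>

lemma enumerates_block_aux:
  assumes "finite A" "0 < m"
  shows "enumerates (block_aux A j m mn a Cs) ((@) Cs ` column_lists A m mn (j - a + 1))"
  using assms
proof (induction A j m mn a Cs rule: block_aux.induct)
  case (1 A j m mn a Cs)
  let ?q = "j - a + 1"
  show ?case
  proof (cases "A = {}")
    case True
    then show ?thesis
      using "1.prems" by (subst block_aux.simps) (simp add: column_lists_empty enumerates_def)
  next
    case A: False
    have Cs_nonempty: "\<exists>B Ds. Es = B # Ds" if "Es \<in> column_lists A m mn ?q" for Es
      using that A by (cases Es) (auto simp: column_lists_def)
    show ?thesis
    proof (cases "card A = m * ?q \<and> mn \<in> A")
      case True
      let ?X = "{B. B \<subseteq> A - {mn} \<and> card B = m - 1}"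
      let ?S = "\<lambda>B. (@) (Cs @ [B \<union> {mn}]) ` column_lists (A - (B \<union> {mn})) m mn ?q"
      have card_ins: "card (B \<union> {mn}) = m" if "B \<in> ?X" for B
      proof -
        have "finite B" using that "1.prems"(1) by (auto intro: finite_subset)
        then show ?thesis using that "1.prems"(2) by (auto simp: card_insert_if)
      qed
      have "block_aux A j m mn a Cs =
          (\<Sum>B\<in>?X. block_aux (A - (B \<union> {mn})) j m mn a (Cs @ [B \<union> {mn}]))"
        using A True "1.prems" by (subst block_aux.simps) simp
      moreover have "enumerates \<dots> (\<Union>B\<in>?X. ?S B)"
      proof (rule enumerates_UN)
        show "finite ?X" using "1.prems"(1) by simp
        show "enumerates (block_aux (A - (B \<union> {mn})) j m mn a (Cs @ [B \<union> {mn}])) (?S B)"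
          if "B \<in> ?X" for B
          using "1.IH"(1) A True "1.prems" that by auto
        \<comment> \<open>\<open>B\<close> avoids \<open>mn\<close>, so it is recovered from the
          chosen column \<open>B \<union> {mn}\<close>.\<close>
        show "disjoint_family_on ?S ?X"
          by (auto simp: disjoint_family_on_def)
      qed
      moreover have "(\<Union>B\<in>?X. ?S B) = (@) Cs ` column_lists A m mn ?q"
      proof (intro equalityI subsetI)
        fix Fs assume "Fs \<in> (\<Union>B\<in>?X. ?S B)"
        then obtain B Ds where B: "B \<in> ?X" and Ds: "Ds \<in> column_lists (A - (B \<union> {mn})) m mn ?q"
          and Fs: "Fs = Cs @ (B \<union> {mn}) # Ds" by auto
        have "(B \<union> {mn}) # Ds \<in> column_lists A m mn ?q"
          unfolding column_lists_Cons[OF "1.prems"] using card_ins[OF B] B Ds True by auto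
        then show "Fs \<in> (@) Cs ` column_lists A m mn ?q" using Fs by blast
      next
        fix Fs assume "Fs \<in> (@) Cs ` column_lists A m mn ?q"
        then obtain B Ds where Fs: "Fs = Cs @ B # Ds" and BD: "B # Ds \<in> column_lists A m mn ?q"
          using Cs_nonempty by blast
        then have B: "B \<subseteq> A" "card B = m" "mn \<in> B" "Ds \<in> column_lists (A - B) m mn ?q"
          using True unfolding column_lists_Cons[OF "1.prems"] by auto
        have eq: "B - {mn} \<union> {mn} = B" using B(3) by auto
        have "B - {mn} \<in> ?X" using B by auto
        moreover have "Fs \<in> ?S (B - {mn})"
          unfolding eq using B(4) Fs by auto
        ultimately show "Fs \<in> (\<Union>B\<in>?X. ?S B)" by blast
      qed
      ultimately show ?thesis by simp
    next
      case False
      let ?X = "{B. B \<subseteq> A \<and> card B = m}"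
      let ?S = "\<lambda>B. (@) (Cs @ [B]) ` column_lists (A - B) m mn ?q"
      have "block_aux A j m mn a Cs = (\<Sum>B\<in>?X. block_aux (A - B) j m mn a (Cs @ [B]))"
        using A False "1.prems" by (subst block_aux.simps) auto
      moreover have "enumerates \<dots> (\<Union>B\<in>?X. ?S B)"
      proof (rule enumerates_UN)
        show "finite ?X" using "1.prems"(1) by simp
        show "enumerates (block_aux (A - B) j m mn a (Cs @ [B])) (?S B)" if "B \<in> ?X" for B
          using "1.IH"(2) A False "1.prems" that by auto
        show "disjoint_family_on ?S ?X"
          by (auto simp: disjoint_family_on_def)
      qed
      moreover have "(\<Union>B\<in>?X. ?S B) = (@) Cs ` column_lists A m mn ?q"
      proof (intro equalityI subsetI)
        fix Fs assume "Fs \<in> (\<Union>B\<in>?X. ?S B)"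
        then obtain B Ds where B: "B \<in> ?X" and Ds: "Ds \<in> column_lists (A - B) m mn ?q"
          and Fs: "Fs = Cs @ B # Ds" by auto
        have "B # Ds \<in> column_lists A m mn ?q"
          unfolding column_lists_Cons[OF "1.prems"] using B Ds False by auto
        then show "Fs \<in> (@) Cs ` column_lists A m mn ?q" using Fs by blast
      next
        fix Fs assume "Fs \<in> (@) Cs ` column_lists A m mn ?q"
        then obtain B Ds where Fs: "Fs = Cs @ B # Ds" and BD: "B # Ds \<in> column_lists A m mn ?q"
          using Cs_nonempty by blast
        then have "B \<in> ?X" "Ds \<in> column_lists (A - B) m mn ?q"
          unfolding column_lists_Cons[OF "1.prems"] by auto
        moreover from this have "Fs \<in> ?S B" using Fs by auto
        ultimately show "Fs \<in> (\<Union>B\<in>?X. ?S B)" by blast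
      qed
      ultimately show ?thesis by simp
    qed
  qed
qed

section \<open>Column lists accepted for one size and for all remaining sizes\<close>

text \<open>The position bound takes its zero-based form here and refers to the union of the columns
  instead of a given set. For \<open>m = 0\<close> all columns are empty, and the unspecified value
  of \<open>Min\<close> has no effect.\<close>

definition balanced_columns :: "nat \<Rightarrow> nat \<Rightarrow> nat \<Rightarrow> nat set list set" where
  "balanced_columns j m a =
     {Cs. length Cs = j \<and> (\<forall>C\<in>set Cs. finite C \<and> card C = m) \<and> disjoint_list Cs \<and>
          (\<forall>l<j. Min (\<Union>(set Cs)) \<in> Cs ! l \<longrightarrow> l < a)}"

lemma card_balanced_columns:
  "Cs \<in> balanced_columns j m a \<Longrightarrow> card (\<Union>(set Cs)) = j * m"
  using card_Union_disjoint_list[of Cs m] by (auto simp: balanced_columns_def)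

text \<open>Lets a size that is not a part count as a choice of \<open>j\<close> empty columns, so
  that all sizes are handled uniformly.\<close>

lemma balanced_columns_0: "balanced_columns j 0 a = {replicate j {}}"
proof -
  have "Cs = replicate j {}" if "Cs \<in> balanced_columns j 0 a" for Cs
    using that by (auto simp: balanced_columns_def intro!: replicate_eqI)
  moreover have "replicate j {} \<in> balanced_columns j 0 a"
    by (auto simp: balanced_columns_def sorted_wrt_iff_nth_less)
  ultimately show ?thesis by blast
qed

definition balanced_tails ::
  "nat multiset \<Rightarrow> (nat \<Rightarrow> nat) \<Rightarrow> nat \<Rightarrow> nat set \<Rightarrow> nat set list list set" where
  "balanced_tails i a j U =
     {Css. length Css = Suc (max_part i) - j \<and>
           (\<forall>k<length Css. Css ! k \<in> balanced_columns (j + k) (count i (j + k)) (a (j + k))) \<and>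
           sorted_wrt (\<lambda>Cs Ds. \<Union>(set Cs) \<inter> \<Union>(set Ds) = {}) Css \<and>
           (\<forall>Cs\<in>set Css. \<Union>(set Cs) \<subseteq> U)}"

lemma balanced_tails_Nil: "max_part i < j \<Longrightarrow> balanced_tails i a j U = {[]}"
  by (auto simp: balanced_tails_def)

lemma balanced_tails_Cons:
  "Cs # Css \<in> balanced_tails i a j U \<longleftrightarrow>
     j \<le> max_part i \<and> Cs \<in> balanced_columns j (count i j) (a j) \<and> \<Union>(set Cs) \<subseteq> U \<and>
     Css \<in> balanced_tails i a (j + 1) (U - \<Union>(set Cs))"
proof -
  have "length (Cs # Css) = Suc (max_part i) - j \<longleftrightarrow>
      j \<le> max_part i \<and> length Css = Suc (max_part i) - (j + 1)" by auto
  moreover have "(\<forall>Ds\<in>set Css. \<Union>(set Cs) \<inter> \<Union>(set Ds) = {}) \<and> (\<forall>Ds\<in>set Css. \<Union>(set Ds) \<subseteq> U) \<longleftrightarrow>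
      (\<forall>Ds\<in>set Css. \<Union>(set Ds) \<subseteq> U - \<Union>(set Cs))" by blast
  moreover have "(\<forall>k<length (Cs # Css). (Cs # Css) ! k \<in> balanced_columns (j + k) (count i (j + k)) (a (j + k)))
      \<longleftrightarrow> Cs \<in> balanced_columns j (count i j) (a j) \<and>
      (\<forall>k<length Css. Css ! k \<in> balanced_columns (j + 1 + k) (count i (j + 1 + k)) (a (j + 1 + k)))"
    by (simp add: All_less_Suc2)
  ultimately show ?thesis
    unfolding balanced_tails_def mem_Collect_eq sorted_wrt.simps list.set ball_simps by blast
qed

text \<open>The number of rows is read off the first column, so that the matrix depends on the
  columns alone and one map serves all sizes and multiplicities.\<close>

definition columns_matrix :: "(nat set \<Rightarrow> nat list) \<Rightarrow> nat set list \<Rightarrow> matrix" where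
  "columns_matrix lst Cs = map (\<lambda>k. map (\<lambda>C. lst C ! k) Cs) [0..<card (hd Cs)]"

text \<open>The cardinality of \<open>A\<close> forces \<open>j\<close> columns, and then the bound
  \<open>l + (j - a + 1) \<le> j\<close> means \<open>l < a\<close>.\<close>

lemma column_lists_eq_balanced_columns:
  assumes "card A = j * m" "0 < m" "0 < a" "a \<le> j"
  shows "column_lists A m (Min A) (j - a + 1) = {Cs \<in> balanced_columns j m a. \<Union>(set Cs) = A}"
proof -
  have "l + (j - a + 1) \<le> j \<longleftrightarrow> l < a" "j - a + 1 \<le> j" for l using assms by auto
  moreover have "length Cs = j" if "Cs \<in> column_lists A m (Min A) (j - a + 1)" for Cs
    using card_Union_disjoint_list[of Cs m] that assms(1,2) by (auto simp: column_lists_def)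
  ultimately show ?thesis unfolding column_lists_def balanced_columns_def by auto
qed

section \<open>From lists of columns to the outputs of \<open>aux\<close>\<close>

context
  fixes lst :: "nat set \<Rightarrow> nat list"
  assumes lst: "\<forall>C. finite C \<longrightarrow> set (lst C) = C \<and> distinct (lst C)"
begin

lemma length_lst: "finite C \<Longrightarrow> length (lst C) = card C"
  using lst distinct_card by metis

text \<open>\<open>lst C\<close> lists the whole of \<open>C\<close>, so the columns are recovered
  from the matrix; this makes \<open>columns_matrix\<close> injective.\<close>

lemma columns_matrix_columns:
  assumes "\<forall>C\<in>set Cs. finite C \<and> card C = m" "l < length Cs"
  shows "(\<lambda>row. row ! l) ` set (columns_matrix lst Cs) = Cs ! l"
proof -
  have "hd Cs \<in> set Cs" using assms(2) by (cases Cs) auto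
  then have hd: "card (hd Cs) = m" using assms(1) by blast
  have C: "finite (Cs ! l)" "card (Cs ! l) = m" using assms nth_mem by blast+
  have "(\<lambda>row. row ! l) ` set (columns_matrix lst Cs) = (\<lambda>k. lst (Cs ! l) ! k) ` {0..<m}"
    using assms(2) by (auto simp: columns_matrix_def hd image_image)
  also have "\<dots> = set (lst (Cs ! l))"
    using C length_lst[OF C(1)] by (auto simp: set_conv_nth)
  finally show ?thesis using lst C by simp
qed

lemma inj_columns_matrix: "inj_on (columns_matrix lst) (balanced_columns j m a)"
proof (rule inj_onI)
  fix Cs Ds assume *: "Cs \<in> balanced_columns j m a" "Ds \<in> balanced_columns j m a"
    "columns_matrix lst Cs = columns_matrix lst Ds"
  then show "Cs = Ds"
    using columns_matrix_columns[of Cs m] columns_matrix_columns[of Ds m]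
    by (auto simp: balanced_columns_def intro!: nth_equalityI)
qed

lemma set_concat_columns_matrix:
  assumes "\<forall>C\<in>set Cs. finite C \<and> card C = m" "Cs \<noteq> []"
  shows "set (concat (columns_matrix lst Cs)) = \<Union>(set Cs)"
proof -
  have len: "length row = length Cs" if "row \<in> set (columns_matrix lst Cs)" for row
    using that by (auto simp: columns_matrix_def)
  have "set row = (!) row ` {..<length Cs}" if "row \<in> set (columns_matrix lst Cs)" for row
    using len[OF that] by (auto simp: set_conv_nth)
  then have "set (concat (columns_matrix lst Cs)) =
      (\<Union>row\<in>set (columns_matrix lst Cs). (!) row ` {..<length Cs})" by simp
  also have "\<dots> = (\<Union>l<length Cs. (\<lambda>row. row ! l) ` set (columns_matrix lst Cs))" by blast
  also have "\<dots> = (\<Union>l<length Cs. Cs ! l)"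
    using columns_matrix_columns[OF assms(1)] by simp
  also have "\<dots> = \<Union>(set Cs)"
    by (auto simp: set_conv_nth)
  finally show ?thesis .
qed

lemma enumerates_block:
  assumes "card A = j * m" "0 < m" "0 < a" "a \<le> j" "finite A"
  shows "enumerates (block lst A j m (Min A) a)
    (columns_matrix lst ` {Cs \<in> balanced_columns j m a. \<Union>(set Cs) = A})"
proof -
  let ?S = "{Cs \<in> balanced_columns j m a. \<Union>(set Cs) = A}"
  have E: "enumerates (block_aux A j m (Min A) a []) ?S"
    using enumerates_block_aux[of A m j "Min A" a "[]"] assms
    unfolding column_lists_eq_balanced_columns[OF assms(1-4)] by simp
  have hd: "card (hd Cs) = m" if "Cs \<in> ?S" for Cs
    using that assms(3,4) by (cases Cs) (auto simp: balanced_columns_def)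
  have "block lst A j m (Min A) a = image_mset (columns_matrix lst) (block_aux A j m (Min A) a [])"
    unfolding block_def
    by (rule image_mset_cong) (use E hd in \<open>auto simp: enumerates_def columns_matrix_def\<close>)
  then show ?thesis
    using enumerates_image[OF E, of "columns_matrix lst"] inj_columns_matrix[of j m a]
    by (auto intro: inj_on_subset)
qed

text \<open>Induction on the number of sizes left. A choice of columns for a part \<open>j\<close>
  stays visible in every output as the matrix at position \<open>length Ms\<close>, so different
  choices give disjoint sets of outputs.\<close>

lemma enumerates_aux:
  assumes a: "\<And>j. 0 < count i j \<Longrightarrow> 0 < a j \<and> a j \<le> j" and "0 < j"
  shows "enumerates (aux lst n i j a Ms)
    ((\<lambda>Css. Ms @ map (columns_matrix lst) Css) ` balanced_tails i a j ({..<n} - set (entries Ms)))"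
  using \<open>0 < j\<close>
proof (induction "Suc (max_part i) - j" arbitrary: j Ms rule: less_induct)
  case less
  let ?U = "{..<n} - set (entries Ms)"
  let ?B = "balanced_columns j (count i j) (a j)"
  let ?out = "\<lambda>Ms. (\<lambda>Css. Ms @ map (columns_matrix lst) Css)"
  let ?S = "\<lambda>Cs. ?out (Ms @ [columns_matrix lst Cs]) `
    balanced_tails i a (j + 1) (?U - \<Union>(set Cs))"
  show ?case
  proof (cases "max_part i < j")
    case True
    then show ?thesis
      by (subst aux.simps) (simp add: balanced_tails_Nil enumerates_def)
  next
    case False
    then have j: "j \<le> max_part i" by simp
    have tails: "?out Ms ` balanced_tails i a j ?U = (\<Union>Cs\<in>{Cs \<in> ?B. \<Union>(set Cs) \<subseteq> ?U}. ?S Cs)"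
    proof (intro equalityI subsetI)
      fix Ns assume "Ns \<in> ?out Ms ` balanced_tails i a j ?U"
      then obtain Css where Css: "Css \<in> balanced_tails i a j ?U" "Ns = ?out Ms Css" by blast
      moreover from Css(1) j have "Css \<noteq> []" by (auto simp: balanced_tails_def)
      ultimately obtain Cs Dss where "Cs # Dss \<in> balanced_tails i a j ?U" "Ns = ?out Ms (Cs # Dss)"
        by (metis neq_Nil_conv)
      then show "Ns \<in> (\<Union>Cs\<in>{Cs \<in> ?B. \<Union>(set Cs) \<subseteq> ?U}. ?S Cs)"
        unfolding balanced_tails_Cons by auto
    next
      fix Ns assume "Ns \<in> (\<Union>Cs\<in>{Cs \<in> ?B. \<Union>(set Cs) \<subseteq> ?U}. ?S Cs)"
      then obtain Cs Dss where "Cs # Dss \<in> balanced_tails i a j ?U" "Ns = ?out Ms (Cs # Dss)"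
        unfolding balanced_tails_Cons using j by auto
      then show "Ns \<in> ?out Ms ` balanced_tails i a j ?U" by blast
    qed
    have IH: "enumerates (aux lst n i (j + 1) a (Ms @ [columns_matrix lst Cs])) (?S Cs)"
      if "Cs \<in> ?B" for Cs
    proof -
      have "Cs \<noteq> []" "\<forall>C\<in>set Cs. finite C \<and> card C = count i j"
        using that less.prems by (auto simp: balanced_columns_def)
      then have "set (entries (Ms @ [columns_matrix lst Cs])) = set (entries Ms) \<union> \<Union>(set Cs)"
        using set_concat_columns_matrix[of Cs "count i j"] by (simp add: entries_def)
      then have "?U - \<Union>(set Cs) = {..<n} - set (entries (Ms @ [columns_matrix lst Cs]))" by auto
      then show ?thesis
        by (simp only:) (rule less.hyps, use j in simp_all)
    qed
    show ?thesis
    proof (cases "0 < count i j")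
      case True
      let ?X = "{A. A \<subseteq> ?U \<and> card A = j * count i j}"
      let ?K = "\<lambda>A. {Cs \<in> ?B. \<Union>(set Cs) = A}"
      have S_nth: "Ns ! length Ms = columns_matrix lst Cs" if "Ns \<in> ?S Cs" for Ns Cs
        using that by (auto simp: nth_append)
      have disj: "?S Cs \<inter> ?S Ds = {}" if "Cs \<in> ?B" "Ds \<in> ?B" "Cs \<noteq> Ds" for Cs Ds
      proof -
        have "columns_matrix lst Cs \<noteq> columns_matrix lst Ds"
          using inj_columns_matrix that by (auto dest: inj_onD)
        then have "Ns \<notin> ?S Ds" if "Ns \<in> ?S Cs" for Ns
          using S_nth[OF that] S_nth[of Ns Ds] by argo
        then show ?thesis by blast
      qed
      have "aux lst n i j a Ms = (\<Sum>A\<in>?X. \<Sum>M\<in>#block lst A j (count i j) (Min A) (a j).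
          aux lst n i (j + 1) a (Ms @ [M]))"
        using False True by (subst aux.simps) simp
      moreover have "enumerates \<dots> (\<Union>A\<in>?X. \<Union>Cs\<in>?K A. ?S Cs)"
      proof (rule enumerates_UN)
        show "finite ?X" by simp
      next
        fix A assume A: "A \<in> ?X"
        then have "finite A" by (auto intro: finite_subset[of A "{..<n}"])
        then have "enumerates (block lst A j (count i j) (Min A) (a j)) (columns_matrix lst ` ?K A)"
          using A True a[OF True] by (intro enumerates_block) auto
        then show "enumerates (\<Sum>M\<in>#block lst A j (count i j) (Min A) (a j).
            aux lst n i (j + 1) a (Ms @ [M])) (\<Union>Cs\<in>?K A. ?S Cs)"
        proof (rule enumerates_sum_mset)
          show "inj_on (columns_matrix lst) (?K A)"
            using inj_columns_matrix by (rule inj_on_subset) auto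
          show "disjoint_family_on ?S (?K A)"
            unfolding disjoint_family_on_def using disj by blast
        qed (use IH in blast)
      next
        show "disjoint_family_on (\<lambda>A. \<Union>Cs\<in>?K A. ?S Cs) ?X"
          unfolding disjoint_family_on_def
        proof (intro ballI impI equals0I)
          fix A A' Ns
          assume "A \<noteq> A'" and "Ns \<in> (\<Union>Cs\<in>?K A. ?S Cs) \<inter> (\<Union>Cs\<in>?K A'. ?S Cs)"
          then obtain Cs Ds where "Cs \<in> ?K A" "Ds \<in> ?K A'" and Ns: "Ns \<in> ?S Cs" "Ns \<in> ?S Ds"
            by (elim IntE UN_E)
          then have "?S Cs \<inter> ?S Ds = {}" using \<open>A \<noteq> A'\<close> by (intro disj) auto
          then show False using Ns by (metis IntI emptyE)
        qed
      qed
      \<comment> \<open>The algorithm picks the set \<open>A\<close> first; grouping the column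
        lists by their union gives the same choices.\<close>
      moreover have "{Cs \<in> ?B. \<Union>(set Cs) \<subseteq> ?U} = (\<Union>A\<in>?X. ?K A)"
        by (auto simp: card_balanced_columns)
      ultimately show ?thesis unfolding tails by (simp only: UN_UN_flatten)
    next
      case zero: False
      let ?E = "replicate j ({} :: nat set)"
      have count: "count i j = 0" using zero by (metis neq0_conv)
      have E: "?B = {?E}" unfolding count by (rule balanced_columns_0)
      \<comment> \<open>The empty matrix appended for multiplicity zero is the matrix of
        \<open>j\<close> empty columns, so this branch is a single instance of the induction
        hypothesis.\<close>
      have "columns_matrix lst ?E = []"
        using less.prems by (cases j) (simp_all add: columns_matrix_def)
      moreover have "aux lst n i j a Ms = aux lst n i (j + 1) a (Ms @ [[]])"
        by (subst aux.simps) (simp only: False zero if_False)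
      ultimately have "aux lst n i j a Ms = aux lst n i (j + 1) a (Ms @ [columns_matrix lst ?E])"
        by (simp only:)
      moreover have "{Cs \<in> ?B. \<Union>(set Cs) \<subseteq> ?U} = {?E}"
        unfolding E by auto
      then have "(\<Union>Cs\<in>{Cs \<in> ?B. \<Union>(set Cs) \<subseteq> ?U}. ?S Cs) = ?S ?E"
        by (simp only: UN_insert UN_empty Un_empty_right)
      moreover have "enumerates (aux lst n i (j + 1) a (Ms @ [columns_matrix lst ?E])) (?S ?E)"
        using E by (intro IH) simp
      ultimately show ?thesis unfolding tails by (simp only:)
    qed
  qed
qed

end

section \<open>The array of greatest common divisors\<close>

text \<open>Invariant of the loop running down from \<open>d\<close> to \<open>k\<close>: the first
  component is the least common multiple of the parts met so far, and an entry of the array is final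
  once written. Only entries at parts are described, since no others are passed to
  \<open>block\<close>.\<close>

lemma fold_gcd_step:
  assumes "k \<le> Suc d" "\<forall>j\<in>#i. j \<le> d"
  shows "fst (fold (gcd_step i) (rev [k..<Suc d]) (1, f)) = Lcm {j \<in> set_mset i. k \<le> j} \<and>
    (\<forall>j\<in>#i. k \<le> j \<longrightarrow>
      snd (fold (gcd_step i) (rev [k..<Suc d]) (1, f)) j = gcd (Lcm {l \<in> set_mset i. j < l}) j)"
  using assms(1)
proof (induction k rule: inc_induct)
  case base
  \<comment> \<open>Before the loop no part has been met, and the initial value 1 is the
    \<open>Lcm\<close> of the empty set.\<close>
  have "{j \<in> set_mset i. Suc d \<le> j} = {}" "[Suc d..<Suc d] = []"
    using assms(2) by fastforce+
  then show ?case using assms(2) by (simp only:) auto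
next
  case (step k)
  let ?st = "fold (gcd_step i) (rev [Suc k..<Suc d]) (1, f)"
  obtain b a where ba: "?st = (b, a)" by fastforce
  have b: "b = Lcm {j \<in> set_mset i. Suc k \<le> j}"
    and a: "\<forall>j\<in>#i. Suc k \<le> j \<longrightarrow> a j = gcd (Lcm {l \<in> set_mset i. j < l}) j"
    using step.IH unfolding ba by simp_all
  have "[k..<Suc d] = k # [Suc k..<Suc d]" using step.hyps by (simp add: upt_rec)
  then have st: "fold (gcd_step i) (rev [k..<Suc d]) (1, f) = gcd_step i k (b, a)"
    using ba by simp
  have Suc_le: "{j \<in> set_mset i. Suc k \<le> j} = {j \<in> set_mset i. k < j}" by auto
  have ins: "{j \<in> set_mset i. k \<le> j} =
      (if k \<in># i then insert k {j \<in> set_mset i. k < j} else {j \<in> set_mset i. k < j})"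
    by (auto simp: le_less)
  have a: "\<forall>j\<in>#i. k < j \<longrightarrow> a j = gcd (Lcm {l \<in> set_mset i. j < l}) j"
    using a by (simp add: Suc_le_eq)
  show ?case unfolding st ins using a
    by (auto simp: gcd_step_def b[unfolded Suc_le] lcm.commute dest: le_neq_implies_less)
qed

lemma le_max_part: "j \<in># i \<Longrightarrow> j \<le> max_part i"
  by (simp add: max_part_def)

lemma gcd_table_eq:
  assumes "j \<in># i" "0 \<notin># i"
  shows "gcd_table i j = gcd (Lcm {k \<in> set_mset i. j < k}) j"
proof -
  have "1 \<le> j" using assms by (cases j) auto
  then show ?thesis
    using fold_gcd_step[of 1 "max_part i" i "\<lambda>_. 0"] le_max_part assms(1)
    by (simp add: gcd_table_def)
qed

lemma sum_times_count:
  fixes i :: "nat multiset"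
  assumes "finite J" "set_mset i \<subseteq> J"
  shows "(\<Sum>j\<in>J. j * count i j) = sum_mset i"
  using assms(2)
proof (induction i)
  case (add x i)
  have "(\<Sum>j\<in>J. j * count (add_mset x i) j) = (\<Sum>j\<in>J. j * count i j + (if j = x then x else 0))"
    by (intro sum.cong) auto
  then show ?case using add assms(1) by (simp add: sum.distrib)
qed simp

lemma sum_count_int_partition:
  assumes "i \<in> int_partitions n"
  shows "(\<Sum>j=1..max_part i. j * count i j) = n"
proof -
  have "set_mset i \<subseteq> {1..max_part i}"
    using assms by (auto simp: le_max_part int_partitions_def Suc_le_eq)
  then show ?thesis
    using assms by (simp add: sum_times_count int_partitions_def)
qed

section \<open>Profiles: block size and position of each element\<close>

text \<open>A profile consists of total functions \<open>sz\<close> and \<open>ps\<close> whose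
  values at \<open>n\<close> and above are arbitrary; the restriction to \<open>x < n\<close> hides
  these values.\<close>

definition column :: "nat \<Rightarrow> (nat \<Rightarrow> nat) \<Rightarrow> (nat \<Rightarrow> nat) \<Rightarrow> nat \<Rightarrow> nat \<Rightarrow> nat set" where
  "column n sz ps j l = {x. x < n \<and> sz x = j \<and> ps x = l}"

definition columns :: "nat \<Rightarrow> nat multiset \<Rightarrow> (nat \<Rightarrow> nat) \<Rightarrow> (nat \<Rightarrow> nat) \<Rightarrow> nat set list list" where
  "columns n i sz ps = map (\<lambda>j. map (column n sz ps j) [0..<j]) [1..<Suc (max_part i)]"

text \<open>An o-block of size \<open>j\<close> has one element at each of its \<open>j\<close>
  positions, so all columns of that size have as many elements as there are o-blocks of that
  size.\<close>

definition balanced :: "nat \<Rightarrow> nat multiset \<Rightarrow> (nat \<Rightarrow> nat) \<Rightarrow> (nat \<Rightarrow> nat) \<Rightarrow> bool" where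
  "balanced n i sz ps \<longleftrightarrow>
     (\<forall>x<n. ps x < sz x) \<and> (\<forall>j. \<forall>l<j. card (column n sz ps j l) = count i j)"

text \<open>The bound \<open>l < a\<close> of \<open>balanced_columns\<close> in terms of positions,
  with the array entry replaced by its closed form.\<close>

definition canonical :: "nat \<Rightarrow> nat multiset \<Rightarrow> (nat \<Rightarrow> nat) \<Rightarrow> (nat \<Rightarrow> nat) \<Rightarrow> bool" where
  "canonical n i sz ps \<longleftrightarrow>
     (\<forall>j\<in>#i. ps (Min {x. x < n \<and> sz x = j}) < gcd (Lcm {k \<in> set_mset i. j < k}) j)"

lemma finite_column [simp]: "finite (column n sz ps j l)"
  by (simp add: column_def)

lemma columns_nth:
  "k < max_part i \<Longrightarrow> columns n i sz ps ! k = map (column n sz ps (Suc k)) [0..<Suc k]"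
  by (simp add: columns_def del: upt_Suc)

lemma length_columns [simp]: "length (columns n i sz ps) = max_part i"
  by (simp add: columns_def)

lemma Union_columns:
  "\<forall>x<n. ps x < sz x \<Longrightarrow> (\<Union>l<j. column n sz ps j l) = {x. x < n \<and> sz x = j}"
  by (auto simp: column_def)

lemma balanced_size_in:
  assumes "balanced n i sz ps" "x < n"
  shows "sz x \<in># i"
proof -
  have "x \<in> column n sz ps (sz x) (ps x)" using assms(2) by (simp add: column_def)
  then have "0 < card (column n sz ps (sz x) (ps x))" by (auto simp: card_gt_0_iff)
  then show ?thesis using assms by (simp add: balanced_def)
qed

lemma balanced_Min:
  assumes "balanced n i sz ps" "j \<in># i" "0 < j"
  shows "Min {x. x < n \<and> sz x = j} < n \<and> sz (Min {x. x < n \<and> sz x = j}) = j"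
proof -
  have "0 < card (column n sz ps j 0)" using assms by (simp add: balanced_def)
  then have "{x. x < n \<and> sz x = j} \<noteq> {}" by (auto simp: card_gt_0_iff column_def)
  then show ?thesis using Min_in[of "{x. x < n \<and> sz x = j}"] by auto
qed

lemma columns_in_balanced_tails:
  assumes i: "i \<in> int_partitions n" and bal: "balanced n i sz ps" and can: "canonical n i sz ps"
  shows "columns n i sz ps \<in> balanced_tails i (gcd_table i) 1 {..<n}"
proof -
  let ?Css = "columns n i sz ps"
  have ps: "\<forall>x<n. ps x < sz x" using bal by (simp add: balanced_def)
  have U: "\<Union>(set (?Css ! k)) = {x. x < n \<and> sz x = Suc k}" if "k < max_part i" for k
  proof -
    have "\<Union>(set (?Css ! k)) = (\<Union>l<Suc k. column n sz ps (Suc k) l)"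
      using that by (simp add: columns_nth atLeast0LessThan del: upt_Suc)
    then show ?thesis using Union_columns[OF ps] by simp
  qed
  have "?Css ! k \<in> balanced_columns (Suc k) (count i (Suc k)) (gcd_table i (Suc k))"
    if k: "k < max_part i" for k
  proof -
    have "l < gcd_table i (Suc k)"
      if l: "l < Suc k" and M: "Min {x. x < n \<and> sz x = Suc k} \<in> column n sz ps (Suc k) l" for l
    proof -
      have "Min {x. x < n \<and> sz x = Suc k} < n" "sz (Min {x. x < n \<and> sz x = Suc k}) = Suc k"
        and psM: "ps (Min {x. x < n \<and> sz x = Suc k}) = l"
        using M by (auto simp: column_def)
      \<comment> \<open>The array is known only at the parts of \<open>i\<close>;
        \<open>Suc k\<close> is one because an element of this size exists.\<close>
      then have "Suc k \<in># i" using balanced_size_in[OF bal] by metis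
      then show ?thesis
        using can psM i gcd_table_eq[of "Suc k" i] by (auto simp: canonical_def int_partitions_def)
    qed
    moreover have "disjoint_list (?Css ! k)"
      using k by (auto simp: columns_nth sorted_wrt_iff_nth_less column_def simp del: upt_Suc)
    moreover have "\<forall>C\<in>set (?Css ! k). finite C \<and> card C = count i (Suc k)"
      using k bal by (simp add: columns_nth balanced_def del: upt_Suc)
    ultimately show ?thesis
      using U[OF k] k by (simp add: balanced_columns_def columns_nth del: upt_Suc)
  qed
  moreover have "sorted_wrt (\<lambda>Cs Ds. \<Union>(set Cs) \<inter> \<Union>(set Ds) = {}) ?Css"
    unfolding sorted_wrt_iff_nth_less by (auto simp: U)
  moreover have "\<Union>(set Cs) \<subseteq> {..<n}" if "Cs \<in> set ?Css" for Cs
    using that U by (auto simp: in_set_conv_nth[of Cs])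
  ultimately show ?thesis unfolding balanced_tails_def by simp
qed

text \<open>By a count, the columns cover every element exactly once. The indices of its column are
  then the size and the position of an element, up to the offset of one between list index and
  size.\<close>

lemma balanced_tails_imp_columns:
  assumes i: "i \<in> int_partitions n" and Css: "Css \<in> balanced_tails i (gcd_table i) 1 {..<n}"
  obtains sz ps where "balanced n i sz ps" "canonical n i sz ps" "Css = columns n i sz ps"
proof -
  let ?d = "max_part i"
  have len: "length Css = ?d"
    and cols: "\<And>k. k < ?d \<Longrightarrow> Css ! k \<in> balanced_columns (Suc k) (count i (Suc k)) (gcd_table i (Suc k))"
    and disj: "\<And>k k'. k < k' \<Longrightarrow> k' < ?d \<Longrightarrow> \<Union>(set (Css ! k)) \<inter> \<Union>(set (Css ! k')) = {}"
    and sub: "\<And>k. k < ?d \<Longrightarrow> \<Union>(set (Css ! k)) \<subseteq> {..<n}"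
    using Css by (auto simp: balanced_tails_def sorted_wrt_iff_nth_less)
  have disj': "\<Union>(set (Css ! k)) \<inter> \<Union>(set (Css ! k')) = {}" if "k < ?d" "k' < ?d" "k \<noteq> k'" for k k'
    using disj[of k k'] disj[of k' k] that by (metis inf_commute linorder_neqE_nat)
  \<comment> \<open>The unions for the various sizes are disjoint subsets of \<open>{..<n}\<close>
    whose cardinalities add up to the sum \<open>n\<close> of the parts, so no element is left
    out.\<close>
  have "card (\<Union>k<?d. \<Union>(set (Css ! k))) = (\<Sum>k<?d. card (\<Union>(set (Css ! k))))"
    using disj' by (intro card_UN_disjoint) (auto intro: finite_subset[OF sub])
  also have "\<dots> = (\<Sum>k<?d. Suc k * count i (Suc k))"
    using card_balanced_columns[OF cols] by simp
  also have "\<dots> = n"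
    using sum_count_int_partition[OF i] by (simp add: sum.atLeast1_atMost_eq)
  finally have U: "(\<Union>k<?d. \<Union>(set (Css ! k))) = {..<n}"
    using sub by (intro card_subset_eq) auto
  have lenk: "length (Css ! k) = Suc k" if "k < ?d" for k
    using cols[OF that] by (simp add: balanced_columns_def)
  have "\<exists>j l. 0 < j \<and> j \<le> ?d \<and> l < j \<and> x \<in> Css ! (j - 1) ! l" if x: "x < n" for x
  proof -
    have "x \<in> (\<Union>k<?d. \<Union>(set (Css ! k)))" using U x by simp
    then obtain k where k: "k < ?d" "x \<in> \<Union>(set (Css ! k))" by blast
    then obtain l where "l < Suc k" "x \<in> Css ! k ! l" using lenk by (metis UnionE in_set_conv_nth)
    then show ?thesis using k by (intro exI[of _ "Suc k"] exI[of _ l]) auto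
  qed
  then obtain sz ps where sz: "\<And>x. x < n \<Longrightarrow> 0 < sz x \<and> sz x \<le> ?d \<and> ps x < sz x \<and> x \<in> Css ! (sz x - 1) ! ps x"
    by metis
  have col: "column n sz ps (Suc k) l = Css ! k ! l" if k: "k < ?d" and l: "l < Suc k" for k l
  proof (intro equalityI subsetI)
    fix x assume "x \<in> column n sz ps (Suc k) l"
    then show "x \<in> Css ! k ! l" using sz[of x] by (auto simp: column_def)
  next
    fix x assume x: "x \<in> Css ! k ! l"
    then have xU: "x \<in> \<Union>(set (Css ! k))" using lenk[OF k] l by (metis UnionI nth_mem)
    then have n: "x < n" using sub[OF k] by auto
    note s = sz[OF n]
    \<comment> \<open>Disjointness between sizes fixes \<open>sz x\<close>, and disjointness of the
      columns within one size fixes \<open>ps x\<close>.\<close>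
    have "sz x - 1 < ?d" using s by auto
    moreover have "x \<in> \<Union>(set (Css ! (sz x - 1)))"
      using s lenk[of "sz x - 1"] by (metis Suc_pred' UnionI \<open>sz x - 1 < ?d\<close> nth_mem)
    ultimately have eq: "sz x - 1 = k" using disj' k xU by blast
    have "disjoint_list (Css ! k)" using cols[OF k] by (simp add: balanced_columns_def)
    then have "\<forall>a b. a < b \<longrightarrow> b < Suc k \<longrightarrow> Css ! k ! a \<inter> Css ! k ! b = {}"
      using lenk[OF k] by (simp add: sorted_wrt_iff_nth_less)
    moreover have "x \<in> Css ! k ! ps x" "ps x < Suc k" using s eq by auto
    ultimately have "ps x = l" using x l by (metis IntI emptyE linorder_neqE_nat)
    then show "x \<in> column n sz ps (Suc k) l" using n s eq by (auto simp: column_def)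
  qed
  have "card (column n sz ps j l) = count i j" if l: "l < j" for j l
  proof (cases "j \<le> ?d")
    case True
    then obtain k where k: "j = Suc k" "k < ?d" using l by (cases j) auto
    have "Css ! k ! l \<in> set (Css ! k)" using lenk k l by auto
    then show ?thesis using cols[OF k(2)] col[OF k(2)] k(1) l by (simp add: balanced_columns_def)
  next
    case False
    then have "j \<notin># i" using le_max_part by blast
    moreover have "column n sz ps j l = {}" using sz False by (auto simp: column_def)
    ultimately show ?thesis by (simp add: not_in_iff)
  qed
  then have bal: "balanced n i sz ps" using sz by (simp add: balanced_def)
  have "ps (Min {x. x < n \<and> sz x = j}) < gcd (Lcm {k \<in> set_mset i. j < k}) j" if j: "j \<in># i" for j
  proof -
    have pos: "0 < j" using i j by (auto simp: int_partitions_def)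
    then obtain k where k: "j = Suc k" "k < ?d" using le_max_part[OF j] by (cases j) auto
    let ?x = "Min {x. x < n \<and> sz x = j}"
    have x: "?x < n" "sz ?x = j" using balanced_Min[OF bal j pos] by auto
    have "\<Union>(set (Css ! k)) = (\<Union>l<Suc k. Css ! k ! l)"
      using lenk[OF k(2)] by (auto simp: set_conv_nth)
    also have "\<dots> = (\<Union>l<j. column n sz ps j l)" using col[OF k(2)] k(1) by simp
    also have "\<dots> = {x. x < n \<and> sz x = j}" using sz by (intro Union_columns) auto
    finally have "Min (\<Union>(set (Css ! k))) \<in> Css ! k ! ps ?x"
      using sz[OF x(1)] x(2) k by simp
    moreover have "ps ?x < Suc k" using sz[OF x(1)] x(2) k by simp
    ultimately have "ps ?x < gcd_table i j" using cols[OF k(2)] k(1) by (simp add: balanced_columns_def)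
    then show ?thesis using gcd_table_eq[OF j] i by (auto simp: int_partitions_def)
  qed
  then have "canonical n i sz ps" by (simp add: canonical_def)
  moreover have "Css = columns n i sz ps"
    using lenk col by (intro nth_equalityI) (auto simp: len columns_nth simp del: upt_Suc intro!: nth_equalityI)
  ultimately show ?thesis using bal that by blast
qed

section \<open>The normal form of a shift\<close>

text \<open>By Bezout, the multiples of \<open>L\<close> represent all multiples of the gcd modulo
  \<open>b\<close>, so \<open>a + s\<close> can be lowered to its remainder modulo the gcd.\<close>

lemma shift_into_gcd:
  fixes a b L s :: nat
  assumes "0 < b"
  obtains t where "(a + (s + t * L)) mod b < gcd L b"
proof -
  let ?g = "gcd L b" and ?v = "a + s"
  obtain x where x: "[L * x = ?g] (mod b)" using cong_solve_nat by blast
  \<comment> \<open>The Bezout coefficient \<open>x\<close> is multiplied by minus the quotient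
    \<open>?v div ?g\<close>; the factor \<open>b - 1\<close> stands for -1 modulo \<open>b\<close>,
    so natural numbers suffice.\<close>
  let ?t = "x * ((b - 1) * (?v div ?g))"
  have "[?t * L = ?g * ((b - 1) * (?v div ?g))] (mod b)"
    using cong_scalar_right[OF x, of "(b - 1) * (?v div ?g)"] by (simp add: ac_simps)
  then have "[?v + ?t * L = ?v + ?g * ((b - 1) * (?v div ?g))] (mod b)"
    by (rule cong_add[OF cong_refl])
  also have "?v + ?g * ((b - 1) * (?v div ?g)) = ?v mod ?g + b * (?g * (?v div ?g))"
  proof -
    have "?v + ?g * ((b - 1) * (?v div ?g)) = ?v mod ?g + (?g * (?v div ?g) + (b - 1) * (?g * (?v div ?g)))"
      using mult_div_mod_eq[of ?g ?v] by (simp add: ac_simps)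
    also have "?g * (?v div ?g) + (b - 1) * (?g * (?v div ?g)) = b * (?g * (?v div ?g))"
      using assms by (cases b) auto
    finally show ?thesis .
  qed
  also have "[\<dots> = ?v mod ?g] (mod b)" by (simp add: cong_def)
  finally have "(?v + ?t * L) mod b = (?v mod ?g) mod b" by (simp add: cong_def)
  also have "\<dots> \<le> ?v mod ?g" by simp
  also have "\<dots> < ?g" using assms by simp
  finally show ?thesis using that[of ?t] by (simp add: add.assoc)
qed

text \<open>Sizes are added in decreasing order. A multiple of \<open>Lcm J\<close> changes no
  remainder for the larger sizes in \<open>J\<close>, and \<open>shift_into_gcd\<close> picks a
  multiple that settles the new least size \<open>b\<close>.\<close>

lemma ex_normalizing_shift:
  fixes J :: "nat set" and p :: "nat \<Rightarrow> nat"
  assumes "finite J" "0 \<notin> J"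
  shows "\<exists>s. \<forall>j\<in>J. (p j + s) mod j < gcd (Lcm {k \<in> J. j < k}) j"
  using assms
proof (induction J rule: finite_linorder_min_induct)
  case (insert b J)
  then obtain s where s: "\<forall>j\<in>J. (p j + s) mod j < gcd (Lcm {k \<in> J. j < k}) j" by auto
  obtain t where t: "(p b + (s + t * Lcm J)) mod b < gcd (Lcm J) b"
    using insert.prems shift_into_gcd[of b] by blast
  have "(p j + (s + t * Lcm J)) mod j = (p j + s) mod j" if j: "j \<in> J" for j
  proof -
    have "j dvd t * Lcm J" using j by auto
    then have "[p j + s + t * Lcm J = p j + s + 0] (mod j)"
      by (intro cong_add cong_refl) (simp add: cong_0_iff)
    then show ?thesis by (simp add: cong_def add.assoc)
  qed
  moreover have "{k \<in> insert b J. j < k} = {k \<in> J. j < k}" if "j \<in> insert b J" for j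
    using insert.hyps that by auto
  moreover have "{k \<in> J. b < k} = J" using insert.hyps by auto
  ultimately show ?case using s t by (intro exI[of _ "s + t * Lcm J"]) auto
qed simp

text \<open>Again a least size \<open>b\<close> is added. The larger sizes divide \<open>s\<close>,
  hence so does the gcd, and \<open>p b\<close> and \<open>q b\<close> are congruent modulo the gcd.
  Both lie below it, so they agree, and \<open>b\<close> divides \<open>s\<close>.\<close>

lemma normalizing_shift_unique:
  fixes J :: "nat set" and p q :: "nat \<Rightarrow> nat"
  assumes "finite J"
    and "\<forall>j\<in>J. p j < gcd (Lcm {k \<in> J. j < k}) j" "\<forall>j\<in>J. q j < gcd (Lcm {k \<in> J. j < k}) j"
    and "\<forall>j\<in>J. q j = (p j + s) mod j"
  shows "\<forall>j\<in>J. j dvd s"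
  using assms
proof (induction J rule: finite_linorder_min_induct)
  case (insert b J)
  have sub: "{k \<in> insert b J. j < k} = {k \<in> J. j < k}" if "j \<in> insert b J" for j
    using insert.hyps that by auto
  have J: "{k \<in> J. b < k} = J" using insert.hyps by auto
  have dvd: "\<forall>j\<in>J. j dvd s"
    using insert.IH insert.prems sub by auto
  let ?g = "gcd (Lcm J) b"
  have "?g dvd s" using dvd by (meson Lcm_least dvd_trans gcd_dvd1)
  have pq: "p b < ?g" "q b < ?g" "q b = (p b + s) mod b"
    using insert.prems sub[of b] J by auto
  then have "[q b = p b + s] (mod b)" by (simp add: cong_def)
  then have "[q b = p b + s] (mod ?g)" by (rule cong_dvd_modulus_nat) simp
  also have "[p b + s = p b + 0] (mod ?g)"
    using \<open>?g dvd s\<close> by (intro cong_add cong_refl) (simp add: cong_0_iff)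
  finally have "q b = p b" using pq by (simp add: cong_def)
  then have "(p b + s) mod b = p b mod b" using pq(3) by (metis mod_mod_trivial)
  then have "[p b + s = p b + 0] (mod b)" by (simp add: cong_def)
  then have "b dvd s" unfolding cong_add_lcancel_nat by (simp add: cong_0_iff)
  then show ?case using dvd by simp
qed simp

text \<open>Adding \<open>s\<close> permutes the residues modulo \<open>j\<close>, so a shift only
  permutes the columns of each size.\<close>

lemma shifted_columns:
  fixes ps :: "nat \<Rightarrow> nat"
  assumes "\<forall>x<n. ps x < sz x" "l < j"
  obtains l' where "l' < j" "column n sz (\<lambda>x. (ps x + s) mod sz x) j l = column n sz ps j l'"
proof -
  let ?f = "\<lambda>a. (a + s) mod j"
  have inj: "inj_on ?f {..<j}"
  proof (rule inj_onI)
    fix a b assume "a \<in> {..<j}" "b \<in> {..<j}" "?f a = ?f b"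
    then have "[a + s = b + s] (mod j)" "a < j" "b < j" by (auto simp: cong_def)
    then show "a = b" unfolding cong_add_rcancel_nat by (simp add: cong_def)
  qed
  moreover have "?f ` {..<j} \<subseteq> {..<j}" using assms(2) by auto
  ultimately have "?f ` {..<j} = {..<j}" by (intro endo_inj_surj) auto
  then have "l \<in> ?f ` {..<j}" using assms(2) by simp
  then obtain l' where l': "l' < j" "?f l' = l" by auto
  have "?f a = l \<longleftrightarrow> a = l'" if "a < j" for a
    using inj_onD[OF inj, of a l'] l' that by auto
  then have "column n sz (\<lambda>x. (ps x + s) mod sz x) j l = column n sz ps j l'"
    using assms(1) by (auto simp: column_def)
  then show ?thesis using that l' by blast
qed

lemma balanced_shift:
  assumes "balanced n i sz ps"
  shows "balanced n i sz (\<lambda>x. (ps x + s) mod sz x)"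
proof -
  have ps: "\<forall>x<n. ps x < sz x" using assms by (simp add: balanced_def)
  have "card (column n sz (\<lambda>x. (ps x + s) mod sz x) j l) = count i j" if "l < j" for j l
    using shifted_columns[OF ps that, of s] assms by (metis balanced_def)
  moreover have "(ps x + s) mod sz x < sz x" if "x < n" for x
    using ps that by (metis gr_implies_not0 mod_less_divisor neq0_conv)
  ultimately show ?thesis by (simp add: balanced_def)
qed

text \<open>Applies \<open>ex_normalizing_shift\<close> to the positions of the least elements;
  every part occurs as a size, so the shift there is taken modulo \<open>j\<close>.\<close>

lemma ex_canonical_shift:
  assumes "balanced n i sz ps" "0 \<notin># i"
  shows "\<exists>s. canonical n i sz (\<lambda>x. (ps x + s) mod sz x)"
proof -
  let ?m = "\<lambda>j. Min {x. x < n \<and> sz x = j}"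
  obtain s where "\<forall>j\<in>#i. (ps (?m j) + s) mod j < gcd (Lcm {k \<in> set_mset i. j < k}) j"
    using ex_normalizing_shift[of "set_mset i" "\<lambda>j. ps (?m j)"] assms(2) by auto
  moreover have "sz (?m j) = j" if "j \<in># i" for j
    using balanced_Min[OF assms(1) that] that assms(2) by (cases j) auto
  ultimately show ?thesis unfolding canonical_def by (intro exI[of _ s]) auto
qed

text \<open>Canonicity constrains only the least elements, but this forces every part to divide
  \<open>s\<close>, and then the shift is trivial at all elements.\<close>

lemma canonical_shift_unique:
  assumes "balanced n i sz ps" "0 \<notin># i" "canonical n i sz ps" "canonical n i sz qs"
    and "\<forall>x<n. qs x = (ps x + s) mod sz x" and "x < n"
  shows "qs x = ps x"
proof -
  let ?m = "\<lambda>j. Min {x. x < n \<and> sz x = j}"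
  have m: "?m j < n \<and> sz (?m j) = j" if "j \<in># i" for j
    using balanced_Min[OF assms(1) that] that assms(2) by (cases j) auto
  have "\<forall>j\<in>#i. j dvd s"
    using assms(3-5) m
    by (intro normalizing_shift_unique[of "set_mset i" "\<lambda>j. ps (?m j)" "\<lambda>j. qs (?m j)"])
       (auto simp: canonical_def)
  then have "sz x dvd s" using balanced_size_in[OF assms(1,6)] by blast
  then have "[ps x + s = ps x + 0] (mod sz x)"
    by (intro cong_add cong_refl) (simp add: cong_0_iff)
  then show ?thesis using assms(1,5,6) by (simp add: cong_def balanced_def)
qed

section \<open>Partitioned orders and their profiles\<close>

text \<open>Existence of a suitable o-block determines it, since o-blocks are disjoint and have
  distinct entries; \<open>realizes_nth\<close> draws this conclusion.\<close>

definition realizes :: "nat \<Rightarrow> (nat \<Rightarrow> nat) \<Rightarrow> (nat \<Rightarrow> nat) \<Rightarrow> nat list set \<Rightarrow> bool" where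
  "realizes n sz ps \<mu> \<longleftrightarrow> \<mu> \<in> BP n \<and>
     (\<forall>x<n. \<exists>S\<in>\<mu>. ps x < sz x \<and> length S = sz x \<and> S ! ps x = x)"

lemma ex_realizes:
  assumes "\<mu> \<in> BP n"
  obtains sz ps where "realizes n sz ps \<mu>"
proof -
  have "\<exists>j l. \<exists>S\<in>\<mu>. l < j \<and> length S = j \<and> S ! l = x" if "x < n" for x
  proof -
    have "x \<in> (\<Union>S\<in>\<mu>. set S)" using assms that by (simp add: BP_def)
    then show ?thesis by (auto simp: in_set_conv_nth)
  qed
  then have "\<forall>x. \<exists>j l. x < n \<longrightarrow> (\<exists>S\<in>\<mu>. l < j \<and> length S = j \<and> S ! l = x)" by blast
  from choice[OF this] obtain sz where
    "\<forall>x. \<exists>l. x < n \<longrightarrow> (\<exists>S\<in>\<mu>. l < sz x \<and> length S = sz x \<and> S ! l = x)" ..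
  from choice[OF this] obtain ps where
    "\<forall>x. x < n \<longrightarrow> (\<exists>S\<in>\<mu>. ps x < sz x \<and> length S = sz x \<and> S ! ps x = x)" ..
  then have "realizes n sz ps \<mu>" using assms unfolding realizes_def by blast
  then show ?thesis by (rule that)
qed

lemma realizes_nth:
  assumes "realizes n sz ps \<mu>" "S \<in> \<mu>" "l < length S"
  shows "S ! l < n" "sz (S ! l) = length S" "ps (S ! l) = l"
proof -
  have BP: "\<mu> \<in> BP n" using assms by (simp add: realizes_def)
  have mem: "S ! l \<in> set S" using assms(3) by simp
  then show n: "S ! l < n" using BP assms(2) by (auto simp: BP_def)
  obtain T where T: "T \<in> \<mu>" "ps (S ! l) < length T" "length T = sz (S ! l)" "T ! ps (S ! l) = S ! l"
    using assms(1) n unfolding realizes_def by metis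
  then have "S ! l \<in> set T" by (metis nth_mem)
  then have "T = S" using BP T(1) assms(2) mem by (auto simp: BP_def)
  then show "sz (S ! l) = length S" "ps (S ! l) = l"
    using T BP assms(2,3) by (auto simp: BP_def nth_eq_iff_index_eq)
qed

lemma realizes_nonempty: "realizes n sz ps \<mu> \<Longrightarrow> S \<in> \<mu> \<Longrightarrow> 0 < length S"
  by (auto simp: realizes_def BP_def)

lemma finite_BP:
  assumes "\<mu> \<in> BP n"
  shows "finite \<mu>"
proof (rule finite_imageD)
  have "set ` \<mu> \<subseteq> Pow {..<n}" using assms by (auto simp: BP_def)
  then show "finite (set ` \<mu>)" by (rule finite_subset) simp
  show "inj_on set \<mu>"
  proof (rule inj_onI, rule ccontr)
    fix S T assume "S \<in> \<mu>" "T \<in> \<mu>" "set S = set T" "S \<noteq> T"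
    moreover from this have "set S \<inter> set T = {}" "S \<noteq> []"
      using assms unfolding BP_def by blast+
    ultimately show False by simp
  qed
qed

text \<open>The partition consists of the lengths of the o-blocks: taking the entry at position
  \<open>l\<close> is a bijection from the o-blocks of size \<open>j\<close> to a column.\<close>

lemma ex_balanced_partition:
  assumes "realizes n sz ps \<mu>"
  shows "\<exists>i\<in>int_partitions n. balanced n i sz ps"
proof
  let ?i = "image_mset length (mset_set \<mu>)"
  have BP: "\<mu> \<in> BP n" using assms by (simp add: realizes_def)
  note fin = finite_BP[OF BP]
  have "sum_mset ?i = (\<Sum>S\<in>\<mu>. length S)" by (simp add: sum_unfold_sum_mset)
  also have "\<dots> = (\<Sum>S\<in>\<mu>. card (set S))"
    using BP by (intro sum.cong) (auto simp: BP_def distinct_card)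
  also have "\<dots> = card (\<Union>S\<in>\<mu>. set S)"
    using BP fin by (intro card_UN_disjoint[symmetric]) (auto simp: BP_def)
  finally show "?i \<in> int_partitions n"
    using BP fin by (auto simp: int_partitions_def BP_def)
  have "card (column n sz ps j l) = count ?i j" if l: "l < j" for j l
  proof -
    have "bij_betw (\<lambda>S. S ! l) {S \<in> \<mu>. length S = j} (column n sz ps j l)"
    proof (rule bij_betwI')
      fix S T assume *: "S \<in> {S \<in> \<mu>. length S = j}" "T \<in> {S \<in> \<mu>. length S = j}"
      have "S = T" if "S ! l = T ! l"
      proof (rule ccontr)
        assume "S \<noteq> T"
        then have "set S \<inter> set T = {}" using BP * by (simp add: BP_def)
        moreover have "S ! l \<in> set S" "T ! l \<in> set T" using * l by auto
        ultimately show False using that by auto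
      qed
      then show "S ! l = T ! l \<longleftrightarrow> S = T" by auto
    next
      fix S assume "S \<in> {S \<in> \<mu>. length S = j}"
      then show "S ! l \<in> column n sz ps j l" using realizes_nth[OF assms] l by (auto simp: column_def)
    next
      fix x assume "x \<in> column n sz ps j l"
      then show "\<exists>S\<in>{S \<in> \<mu>. length S = j}. x = S ! l"
        using assms by (fastforce simp: realizes_def column_def)
    qed
    then have "card (column n sz ps j l) = card {S \<in> \<mu>. length S = j}"
      using bij_betw_same_card by metis
    then show ?thesis
      using fin by (simp add: count_image_mset' Collect_conj_eq[symmetric]) (auto intro: arg_cong[where f = card])
  qed
  moreover have "\<forall>x<n. ps x < sz x" using assms by (auto simp: realizes_def)
  ultimately show "balanced n ?i sz ps" by (simp add: balanced_def)
qed

text \<open>Summed over the columns, \<open>j * count i j\<close> is the number of elements of size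
  \<open>j\<close>, which depends on \<open>sz\<close> alone. At \<open>j = 0\<close> this gives
  nothing, and the positivity of the parts steps in.\<close>

lemma balanced_partition_unique:
  assumes "balanced n i sz ps" "balanced n i' sz ps'" "0 \<notin># i" "0 \<notin># i'"
  shows "i = i'"
proof (rule multiset_eqI)
  fix j
  have card: "card {x. x < n \<and> sz x = j} = j * count k j" if "balanced n k sz qs" for k qs
  proof -
    have "{x. x < n \<and> sz x = j} = (\<Union>l<j. column n sz qs j l)"
      using that by (intro Union_columns[symmetric]) (simp add: balanced_def)
    also have "card \<dots> = (\<Sum>l<j. card (column n sz qs j l))"
      by (intro card_UN_disjoint) (auto simp: column_def)
    also have "\<dots> = j * count k j" using that by (simp add: balanced_def)
    finally show ?thesis .
  qed
  have "j * count i j = j * count i' j" 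
    by (rule trans[OF card[OF assms(1), symmetric] card[OF assms(2)]])
  then show "count i j = count i' j"
    using assms(3,4) by (cases "j = 0") (simp_all add: not_in_iff)
qed

section \<open>Sequences of blocks and their circular shifts\<close>

lemma blocks_eq:
  assumes "realizes n sz ps \<mu>"
  shows "blocks \<mu> = map (\<lambda>t. {x. x < n \<and> t mod sz x = ps x}) [0..<Lcm (sz ` {..<n})]"
proof -
  have "length ` \<mu> = sz ` {..<n}"
  proof (intro equalityI subsetI)
    fix j assume "j \<in> length ` \<mu>"
    then obtain S where S: "S \<in> \<mu>" "j = length S" by blast
    then have "0 < length S" using realizes_nonempty[OF assms] by blast
    then show "j \<in> sz ` {..<n}" using realizes_nth(1,2)[OF assms S(1), of 0] S(2) by force
  next
    fix j assume "j \<in> sz ` {..<n}"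
    then obtain x where "x < n" "j = sz x" by auto
    then show "j \<in> length ` \<mu>" using assms by (force simp: realizes_def)
  qed
  moreover have "{S ! (t mod length S) |S. S \<in> \<mu>} = {x. x < n \<and> t mod sz x = ps x}" for t
  proof (intro equalityI subsetI)
    fix x assume "x \<in> {S ! (t mod length S) |S. S \<in> \<mu>}"
    then obtain S where S: "S \<in> \<mu>" "x = S ! (t mod length S)" by blast
    then have "t mod length S < length S" using realizes_nonempty[OF assms] by simp
    then show "x \<in> {x. x < n \<and> t mod sz x = ps x}" using realizes_nth[OF assms S(1)] S(2) by simp
  next
    fix x assume "x \<in> {x. x < n \<and> t mod sz x = ps x}"
    then show "x \<in> {S ! (t mod length S) |S. S \<in> \<mu>}" using assms unfolding realizes_def by force
  qed
  ultimately show ?thesis unfolding blocks_def by simp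
qed

text \<open>Reading positions modulo the length removes the subtraction in \<open>cshift\<close>. As
  \<open>u\<close> ranges over all naturals, its quantifier can later be exchanged with the one over
  elements.\<close>

lemma eq_cshift_iff:
  assumes "length xs = length ys" "0 < length ys"
  shows "xs = cshift (int s) ys \<longleftrightarrow> (\<forall>u. xs ! ((u + s) mod length ys) = ys ! (u mod length ys))"
proof -
  let ?p = "length ys"
  have unshift: "nat ((int ((u + s) mod ?p) - int s) mod int ?p) = u mod ?p" for u
  proof -
    have "(int ((u + s) mod ?p) - int s) mod int ?p = (int (u + s) - int s) mod int ?p"
      by (simp only: zmod_int mod_diff_left_eq)
    also have "\<dots> = int (u mod ?p)" by (simp add: zmod_int)
    finally show ?thesis by simp
  qed
  \<comment> \<open>Every position is \<open>u + s\<close> modulo the length for some natural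
    \<open>u\<close>, found by subtracting \<open>s\<close> among the integers.\<close>
  have residues: "\<exists>u. t = (u + s) mod ?p" if "t < ?p" for t
  proof -
    have "(nat ((int t - int s) mod int ?p) + s) mod ?p = t"
    proof -
      have nn: "0 \<le> (int t - int s) mod int ?p" using assms(2) by simp
      have "int ((nat ((int t - int s) mod int ?p) + s) mod ?p) =
          ((int t - int s) mod int ?p + int s) mod int ?p"
        using nn by (simp add: zmod_int)
      also have "\<dots> = int t mod int ?p" by (simp only: mod_add_left_eq) simp
      finally show ?thesis using that by (simp add: zmod_int[symmetric])
    qed
    then show ?thesis by metis
  qed
  have "xs = cshift (int s) ys \<longleftrightarrow> (\<forall>t<?p. xs ! t = cshift (int s) ys ! t)"
    using assms(1) by (auto simp: list_eq_iff_nth_eq)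
  also have "\<dots> \<longleftrightarrow> (\<forall>u. xs ! ((u + s) mod ?p) = cshift (int s) ys ! ((u + s) mod ?p))"
    using residues assms(2) by (metis mod_less_divisor)
  also have "\<dots> \<longleftrightarrow> (\<forall>u. xs ! ((u + s) mod ?p) = ys ! (u mod ?p))"
    using assms(2) by (simp add: nth_cshift unshift)
  finally show ?thesis .
qed

text \<open>A residue class determines its modulus. The step from \<open>b\<close> to
  \<open>b + k\<close> stays in the class modulo \<open>k\<close>, hence in the corresponding one
  modulo \<open>j\<close>, so \<open>j\<close> divides \<open>k\<close>; the step by
  \<open>j\<close> gives the converse.\<close>

lemma arithmetic_progressions_eq_iff:
  fixes a b j k s :: nat
  assumes "a < j" "b < k"
  shows "(\<forall>u. (u + s) mod j = a \<longleftrightarrow> u mod k = b) \<longleftrightarrow> j = k \<and> a = (b + s) mod j"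
proof
  assume u: "\<forall>u. (u + s) mod j = a \<longleftrightarrow> u mod k = b"
  have a: "(b + s) mod j = a" using spec[OF u, of b] assms by simp
  have "(b + k + s) mod j = a" using spec[OF u, of "b + k"] assms by simp
  then have "[b + s + k = b + s + 0] (mod j)" using a by (simp add: cong_def ac_simps)
  then have "j dvd k" unfolding cong_add_lcancel_nat by (simp add: cong_0_iff)
  moreover have "(b + j + s) mod j = (b + s) mod j"
    by (metis add.assoc add.commute mod_add_self2)
  then have "(b + j) mod k = b" using spec[OF u, of "b + j"] a by simp
  then have "[b + j = b + 0] (mod k)" using assms by (simp add: cong_def)
  then have "k dvd j" unfolding cong_add_lcancel_nat by (simp add: cong_0_iff)
  ultimately show "j = k \<and> a = (b + s) mod j" using a by (auto intro: dvd_antisym)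
next
  assume *: "j = k \<and> a = (b + s) mod j"
  then have "(u + s) mod j = a \<longleftrightarrow> [u + s = b + s] (mod j)" for u by (simp add: cong_def)
  then show "\<forall>u. (u + s) mod j = a \<longleftrightarrow> u mod k = b"
    unfolding cong_add_rcancel_nat using * assms by (simp add: cong_def)
qed

text \<open>The quantifiers over times \<open>u\<close> and elements \<open>x\<close> commute, so
  equality of block sequences splits into one comparison of residue classes per element, with the
  same \<open>s\<close> throughout.\<close>

lemma BP_iso_iff_shift:
  assumes r: "realizes n sz ps \<mu>" and r': "realizes n sz' ps' \<mu>'"
  shows "(\<mu>, \<mu>') \<in> BP_iso n \<longleftrightarrow> (\<exists>s. \<forall>x<n. sz x = sz' x \<and> ps x = (ps' x + s) mod sz x)"
proof -
  let ?p = "Lcm (sz ` {..<n})" and ?p' = "Lcm (sz' ` {..<n})"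
  have BP: "\<mu> \<in> BP n" "\<mu>' \<in> BP n" using assms by (auto simp: realizes_def)
  have len: "length (blocks \<mu>) = ?p" "length (blocks \<mu>') = ?p'"
    using blocks_eq[OF r] blocks_eq[OF r'] by simp_all
  have p': "0 < ?p'" using length_blocks_pos[OF BP(2)] len by simp
  have shift: "blocks \<mu> = cshift (int s) (blocks \<mu>') \<longleftrightarrow>
      ?p = ?p' \<and> (\<forall>x<n. sz x = sz' x \<and> ps x = (ps' x + s) mod sz x)" for s
  proof (cases "?p = ?p'")
    case True
    \<comment> \<open>Every size divides the period, so reducing the time modulo the period first
      changes nothing.\<close>
    have "blocks \<mu> ! ((u + s) mod ?p') = {x. x < n \<and> (u + s) mod sz x = ps x}"
      and "blocks \<mu>' ! (u mod ?p') = {x. x < n \<and> u mod sz' x = ps' x}" for u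
    proof -
      have "(u + s) mod ?p' mod sz x = (u + s) mod sz x" "u mod ?p' mod sz' x = u mod sz' x"
        if "x < n" for x
      proof -
        have "sz x dvd ?p" "sz' x dvd ?p'" using that by (auto intro: dvd_Lcm)
        then show "(u + s) mod ?p' mod sz x = (u + s) mod sz x" "u mod ?p' mod sz' x = u mod sz' x"
          unfolding True by (auto simp: mod_mod_cancel)
      qed
      then show "blocks \<mu> ! ((u + s) mod ?p') = {x. x < n \<and> (u + s) mod sz x = ps x}"
        "blocks \<mu>' ! (u mod ?p') = {x. x < n \<and> u mod sz' x = ps' x}"
        using p' by (auto simp: blocks_eq[OF r] blocks_eq[OF r'] True)
    qed
    then have "blocks \<mu> = cshift (int s) (blocks \<mu>') \<longleftrightarrow>
        (\<forall>u. {x. x < n \<and> (u + s) mod sz x = ps x} = {x. x < n \<and> u mod sz' x = ps' x})"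
      using eq_cshift_iff[of "blocks \<mu>" "blocks \<mu>'" s] len True p' by simp
    also have "\<dots> \<longleftrightarrow> (\<forall>x<n. \<forall>u. (u + s) mod sz x = ps x \<longleftrightarrow> u mod sz' x = ps' x)" by blast
    also have "\<dots> \<longleftrightarrow> (\<forall>x<n. sz x = sz' x \<and> ps x = (ps' x + s) mod sz x)"
      using r r' by (auto simp: realizes_def arithmetic_progressions_eq_iff)
    finally show ?thesis using True by simp
  next
    case False
    then show ?thesis using len by (metis length_cshift)
  qed
  show ?thesis
  proof
    assume "(\<mu>, \<mu>') \<in> BP_iso n"
    then show "\<exists>s. \<forall>x<n. sz x = sz' x \<and> ps x = (ps' x + s) mod sz x"
      using shift by (auto simp: BP_iso_def)
  next
    assume "\<exists>s. \<forall>x<n. sz x = sz' x \<and> ps x = (ps' x + s) mod sz x"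
    then obtain s where s: "\<forall>x<n. sz x = sz' x \<and> ps x = (ps' x + s) mod sz x" by blast
    then have "sz ` {..<n} = sz' ` {..<n}" by (auto intro: image_cong)
    then have "blocks \<mu> = cshift (int s) (blocks \<mu>')" using shift s by simp
    \<comment> \<open>\<open>BP_iso\<close> asks for a shift below the number of blocks.\<close>
    then have "blocks \<mu> = cshift (int (s mod ?p')) (blocks \<mu>')"
      using cshift_mod[of "int s" "blocks \<mu>'"] len by (simp add: zmod_int)
    moreover have "s mod ?p' < length (blocks \<mu>')" using p' len by simp
    ultimately show "(\<mu>, \<mu>') \<in> BP_iso n" using BP by (auto simp: BP_iso_def)
  qed
qed

section \<open>The outputs of the algorithm\<close>

lemma matrix_rep_represented:
  assumes "matrix_rep n i Ms"
  shows "represented Ms \<in> BP n"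
proof -
  have rows: "S \<noteq> []" if S: "S \<in> represented Ms" for S
  proof -
    obtain M where "M \<in> set Ms" "S \<in> set M" using S by (auto simp: represented_def)
    then obtain k where k: "k < length Ms" "S \<in> set (Ms ! k)" by (metis in_set_conv_nth)
    then have "Suc k \<in> {1..max_part i}" using assms by (simp add: matrix_rep_def)
    then have "length S = Suc k" using assms k(2) unfolding matrix_rep_def by fastforce
    then show ?thesis by auto
  qed
  have "distinct (concat (concat Ms))" "set (concat (concat Ms)) = {..<n}"
    using assms by (auto simp: matrix_rep_def entries_def)
  then show ?thesis
    using rows unfolding BP_def represented_def distinct_concat_iff by simp
qed

text \<open>The multiplicities are the numbers of rows, so the runs for different partitions share
  no output.\<close>

lemma matrix_rep_unique:
  assumes "matrix_rep n i Ms" "matrix_rep n i' Ms" "0 \<notin># i" "0 \<notin># i'"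
  shows "i = i'"
proof (rule multiset_eqI)
  fix j
  have max: "max_part i = max_part i'" using assms by (simp add: matrix_rep_def)
  show "count i j = count i' j"
  proof (cases "j \<in> {1..max_part i}")
    case True
    then show ?thesis using assms max by (simp add: matrix_rep_def)
  next
    case False
    then have "j \<notin># i" "j \<notin># i'"
      using assms(3,4) le_max_part[of j i] le_max_part[of j i'] max by (cases j; auto)+
    then show ?thesis by (simp add: not_in_iff)
  qed
qed

lemma length_concat_const:
  "\<forall>r\<in>set M. length r = j \<Longrightarrow> length (concat M) = j * length M"
  by (induction M) auto

lemma length_entries: "length (entries Ms) = (\<Sum>M\<leftarrow>Ms. length (concat M))"
  unfolding entries_def by (induction Ms) auto

context
  fixes lst :: "nat set \<Rightarrow> nat list"
  assumes lst: "\<forall>C. finite C \<longrightarrow> set (lst C) = C \<and> distinct (lst C)"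
begin

definition profile_matrices :: "nat \<Rightarrow> nat multiset \<Rightarrow> (nat \<Rightarrow> nat) \<Rightarrow> (nat \<Rightarrow> nat) \<Rightarrow> matrix list" where
  "profile_matrices n i sz ps = map (columns_matrix lst) (columns n i sz ps)"

text \<open>The entries are free of repetition by counting: their list has length \<open>n\<close>,
  the sum of the parts, and contains all \<open>n\<close> elements.\<close>

lemma matrix_rep_profile_matrices:
  assumes i: "i \<in> int_partitions n" and bal: "balanced n i sz ps"
  shows "matrix_rep n i (profile_matrices n i sz ps)"
proof -
  let ?Ms = "profile_matrices n i sz ps" and ?d = "max_part i"
  have ps: "\<forall>x<n. ps x < sz x" using bal by (simp add: balanced_def)
  have nth: "?Ms ! k = columns_matrix lst (map (column n sz ps (Suc k)) [0..<Suc k])" if "k < ?d" for k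
    using that by (simp add: profile_matrices_def columns_nth del: upt_Suc)
  have len: "length ?Ms = ?d" by (simp add: profile_matrices_def)
  have mat: "length (?Ms ! k) = count i (Suc k) \<and> (\<forall>row\<in>set (?Ms ! k). length row = Suc k)"
    if "k < ?d" for k
  proof -
    have "hd (map (column n sz ps (Suc k)) [0..<Suc k]) = column n sz ps (Suc k) 0"
      by (simp add: hd_map del: upt_Suc)
    then show ?thesis
      using bal by (auto simp: nth[OF that] columns_matrix_def balanced_def simp del: upt_Suc)
  qed
  have ent: "set (concat (?Ms ! k)) = {x. x < n \<and> sz x = Suc k}" if "k < ?d" for k
  proof -
    have "set (concat (?Ms ! k)) = \<Union>(set (map (column n sz ps (Suc k)) [0..<Suc k]))"
      unfolding nth[OF that] using bal
      by (intro set_concat_columns_matrix[OF lst, where m = "count i (Suc k)"])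
         (auto simp: balanced_def simp del: upt_Suc)
    also have "\<dots> = (\<Union>l<Suc k. column n sz ps (Suc k) l)"
      by (simp add: atLeast0LessThan del: upt_Suc)
    finally show ?thesis using Union_columns[OF ps] by simp
  qed
  have "set (entries ?Ms) = (\<Union>M\<in>set ?Ms. set (concat M))"
    by (simp add: entries_def)
  also have "\<dots> = (\<Union>k<?d. set (concat (?Ms ! k)))"
    unfolding set_conv_nth[of ?Ms] len by blast
  also have "\<dots> = (\<Union>k<?d. {x. x < n \<and> sz x = Suc k})"
    using ent by auto
  also have "\<dots> = {..<n}"
  proof (intro equalityI subsetI)
    fix x assume "x \<in> {..<n}"
    then have "x < n" "sz x \<noteq> 0" "sz x \<le> ?d"
      using ps le_max_part balanced_size_in[OF bal, of x] by force+
    then show "x \<in> (\<Union>k<?d. {x. x < n \<and> sz x = Suc k})"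
      by (intro UN_I[of "sz x - 1"]) auto
  qed auto
  finally have set: "set (entries ?Ms) = {..<n}" .
  have "length (entries ?Ms) = (\<Sum>k<?d. length (concat (?Ms ! k)))"
    by (simp add: length_entries sum_list_sum_nth len atLeast0LessThan)
  also have "\<dots> = (\<Sum>k<?d. Suc k * count i (Suc k))"
  proof (rule sum.cong[OF refl])
    fix k assume "k \<in> {..<?d}"
    then show "length (concat (?Ms ! k)) = Suc k * count i (Suc k)"
      using mat[of k] length_concat_const[of "?Ms ! k" "Suc k"] by simp
  qed
  also have "\<dots> = n"
    using sum_count_int_partition[OF i] by (simp add: sum.atLeast1_atMost_eq)
  finally have "distinct (entries ?Ms)" using set by (intro card_distinct) simp
  moreover have "length (?Ms ! (j - 1)) = count i j \<and> (\<forall>row\<in>set (?Ms ! (j - 1)). length row = j)"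
    if "j \<in> {1..?d}" for j
    using that mat[of "j - 1"] by auto
  ultimately show ?thesis using set len by (simp add: matrix_rep_def)
qed

text \<open>Column \<open>ps x\<close> of the matrix for size \<open>sz x\<close> contains
  \<open>x\<close>, so some row has \<open>x\<close> at this position; this row is the o-block of
  \<open>x\<close>.\<close>

lemma realizes_profile_matrices:
  assumes i: "i \<in> int_partitions n" and bal: "balanced n i sz ps"
  shows "realizes n sz ps (represented (profile_matrices n i sz ps))"
proof -
  let ?Ms = "profile_matrices n i sz ps" and ?d = "max_part i"
  have rep: "matrix_rep n i ?Ms" using matrix_rep_profile_matrices assms by blast
  have "\<exists>S\<in>represented ?Ms. ps x < sz x \<and> length S = sz x \<and> S ! ps x = x" if x: "x < n" for x
  proof -
    have p: "ps x < sz x" using bal x by (simp add: balanced_def)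
    then obtain k where k: "sz x = Suc k" by (cases "sz x") auto
    then have kd: "k < ?d" using le_max_part balanced_size_in[OF bal x] by force
    let ?Cs = "map (column n sz ps (Suc k)) [0..<Suc k]"
    have M: "?Ms ! k = columns_matrix lst ?Cs"
      using kd by (simp add: profile_matrices_def columns_nth del: upt_Suc)
    have "(\<lambda>row. row ! ps x) ` set (?Ms ! k) = ?Cs ! ps x"
      unfolding M using bal p k
      by (intro columns_matrix_columns[OF lst, where m = "count i (Suc k)"])
         (auto simp: balanced_def simp del: upt_Suc)
    moreover have "x \<in> ?Cs ! ps x" using p k x by (simp add: column_def del: upt_Suc)
    ultimately obtain S where S: "S \<in> set (?Ms ! k)" "S ! ps x = x" by (metis imageE)
    moreover have "?Ms ! k \<in> set ?Ms" using kd by (simp add: profile_matrices_def)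
    moreover have "Suc k \<in> {1..?d}" using kd by simp
    then have "length S = Suc k" using rep S(1) unfolding matrix_rep_def by fastforce
    ultimately show ?thesis using p k by (auto simp: represented_def)
  qed
  then show ?thesis using matrix_rep_represented[OF rep] by (simp add: realizes_def)
qed

text \<open>Profiles that differ only at \<open>n\<close> and above give the same matrices;
  collecting the matrices in a set counts them once.\<close>

lemma enumerates_EnumBPiso:
  "enumerates (EnumBPiso lst n)
     (\<Union>i\<in>int_partitions n. {profile_matrices n i sz ps |sz ps. balanced n i sz ps \<and> canonical n i sz ps})"
  unfolding EnumBPiso_def
proof (rule enumerates_UN)
  let ?X = "\<lambda>i. {profile_matrices n i sz ps |sz ps. balanced n i sz ps \<and> canonical n i sz ps}"
  show "finite (int_partitions n)" by (rule finite_int_partitions)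
  show "enumerates (aux lst n i 1 (gcd_table i) []) (?X i)" if i: "i \<in> int_partitions n" for i
  proof -
    have gcd: "0 < gcd_table i j \<and> gcd_table i j \<le> j" if "0 < count i j" for j
    proof -
      have "j \<in># i" "0 \<notin># i" using that i by (auto simp: int_partitions_def)
      moreover from this have "0 < j" by (cases j) auto
      ultimately show ?thesis by (simp add: gcd_table_eq)
    qed
    have "map (columns_matrix lst) ` balanced_tails i (gcd_table i) 1 {..<n} = ?X i"
    proof (intro equalityI subsetI)
      fix Ms assume "Ms \<in> map (columns_matrix lst) ` balanced_tails i (gcd_table i) 1 {..<n}"
      then obtain Css where "Css \<in> balanced_tails i (gcd_table i) 1 {..<n}"
        and Ms: "Ms = map (columns_matrix lst) Css" by blast
      then obtain sz ps where "balanced n i sz ps" "canonical n i sz ps" "Css = columns n i sz ps"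
        using balanced_tails_imp_columns[OF i] by metis
      then show "Ms \<in> ?X i" using Ms by (auto simp: profile_matrices_def)
    next
      fix Ms assume "Ms \<in> ?X i"
      then show "Ms \<in> map (columns_matrix lst) ` balanced_tails i (gcd_table i) 1 {..<n}"
        using columns_in_balanced_tails[OF i] by (auto simp: profile_matrices_def)
    qed
    then show ?thesis
      using enumerates_aux[OF lst gcd, of i 1 n "[]"] by (simp add: entries_def)
  qed
  show "disjoint_family_on ?X (int_partitions n)"
    unfolding disjoint_family_on_def
  proof (intro ballI impI equals0I)
    fix i i' Ms
    assume i: "i \<in> int_partitions n" "i' \<in> int_partitions n" "i \<noteq> i'" and Ms: "Ms \<in> ?X i \<inter> ?X i'"
    have "matrix_rep n i Ms" "matrix_rep n i' Ms"
      using Ms i matrix_rep_profile_matrices by auto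
    moreover have "0 \<notin># i" "0 \<notin># i'" using i by (auto simp: int_partitions_def)
    ultimately show False using matrix_rep_unique i(3) by blast
  qed
qed

text \<open>For existence, a profile of \<open>\<mu>\<close> is shifted into canonical form. For
  uniqueness, \<open>BP_iso_iff_shift\<close> makes the profile of any equivalent output a shift of
  that one, and \<open>canonical_shift_unique\<close> makes this shift trivial.\<close>

lemma ex1_profile_matrices:
  assumes "\<mu> \<in> BP n"
  shows "\<exists>!M. M \<in># EnumBPiso lst n \<and> (\<mu>, represented M) \<in> BP_iso n"
proof -
  have mem: "M \<in># EnumBPiso lst n \<longleftrightarrow>
      (\<exists>i\<in>int_partitions n. \<exists>sz ps. M = profile_matrices n i sz ps \<and> balanced n i sz ps \<and> canonical n i sz ps)" for M
    using enumerates_EnumBPiso[of n] by (auto simp: enumerates_def)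
  have sym: "(\<mu>, \<nu>) \<in> BP_iso n \<Longrightarrow> (\<nu>, \<mu>) \<in> BP_iso n" for \<mu> \<nu>
    using equiv_BP_iso by (meson equivE symE)
  have trans: "(\<mu>, \<nu>) \<in> BP_iso n \<Longrightarrow> (\<nu>, \<xi>) \<in> BP_iso n \<Longrightarrow> (\<mu>, \<xi>) \<in> BP_iso n" for \<mu> \<nu> \<xi>
    using equiv_BP_iso by (meson equivE transE)
  obtain sz ps where r: "realizes n sz ps \<mu>" using ex_realizes assms by blast
  obtain i where i: "i \<in> int_partitions n" and bal: "balanced n i sz ps"
    using ex_balanced_partition[OF r] by blast
  have pos: "0 \<notin># i'" if "i' \<in> int_partitions n" for i' using that by (auto simp: int_partitions_def)
  obtain s where can: "canonical n i sz (\<lambda>x. (ps x + s) mod sz x)"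
    using ex_canonical_shift[OF bal pos[OF i]] by blast
  let ?qs = "\<lambda>x. (ps x + s) mod sz x"
  have bal': "balanced n i sz ?qs" using balanced_shift[OF bal] .
  let ?M = "profile_matrices n i sz ?qs"
  have r': "realizes n sz ?qs (represented ?M)" using realizes_profile_matrices[OF i bal'] .
  have "(represented ?M, \<mu>) \<in> BP_iso n"
    unfolding BP_iso_iff_shift[OF r' r] by (rule exI[of _ s]) simp
  then have iso: "(\<mu>, represented ?M) \<in> BP_iso n" by (rule sym)
  have "M = ?M" if M: "M \<in># EnumBPiso lst n" "(\<mu>, represented M) \<in> BP_iso n" for M
  proof -
    obtain i' sz' ps' where i': "i' \<in> int_partitions n" and M_eq: "M = profile_matrices n i' sz' ps'"
      and b: "balanced n i' sz' ps'" and c: "canonical n i' sz' ps'"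
      using M(1) mem by blast
    have "realizes n sz' ps' (represented M)" using realizes_profile_matrices[OF i' b] M_eq by simp
    moreover have "(represented M, represented ?M) \<in> BP_iso n" using M(2) iso sym trans by blast
    ultimately obtain t where t: "\<forall>x<n. sz' x = sz x \<and> ps' x = (?qs x + t) mod sz' x"
      using BP_iso_iff_shift[OF _ r'] by blast
    \<comment> \<open>Below \<open>n\<close> the two size functions agree, so \<open>sz\<close> may
      replace \<open>sz'\<close>: columns and least elements look no further.\<close>
    have sz: "{x. x < n \<and> sz' x = j} = {x. x < n \<and> sz x = j}" for j using t by auto
    have col: "column n sz' ps' j l = column n sz ps' j l" for j l using t by (auto simp: column_def)
    have b': "balanced n i' sz ps'" using b t by (auto simp: balanced_def col)
    have c': "canonical n i' sz ps'" using c by (simp add: canonical_def sz)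
    have ii: "i' = i" using balanced_partition_unique[OF b' bal'] pos i i' by blast
    have "ps' x = ?qs x" if "x < n" for x
      using canonical_shift_unique[OF bal' pos[OF i] can c'[unfolded ii] _ that, of t] t by simp
    then have "column n sz' ps' j l = column n sz ?qs j l" for j l
      using t by (auto simp: column_def)
    then have "columns n i' sz' ps' = columns n i sz ?qs" by (simp add: columns_def ii)
    then show ?thesis using M_eq by (simp add: profile_matrices_def)
  qed
  moreover have "?M \<in># EnumBPiso lst n" using mem i bal' can by blast
  ultimately show ?thesis using iso by blast
qed

end

theorem theorem5:
  fixes n :: nat and lst :: "nat set \<Rightarrow> nat list"
  assumes "n \<ge> 1"
    and "\<forall>C. finite C \<longrightarrow> set (lst C) = C \<and> distinct (lst C)"
  shows "(\<forall>M\<in>#EnumBPiso lst n.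
            (\<exists>i\<in>int_partitions n. matrix_rep n i M) \<and> represented M \<in> BP n) \<and>
         (\<forall>c\<in>BP_star n. size {#M \<in># EnumBPiso lst n. represented M \<in> c#} = 1)"
proof (intro conjI ballI)
  note E = enumerates_EnumBPiso[OF assms(2), of n]
  fix M assume "M \<in># EnumBPiso lst n"
  then obtain i sz ps where "i \<in> int_partitions n" "balanced n i sz ps" "M = profile_matrices lst n i sz ps"
    using E by (auto simp: enumerates_def)
  then show "\<exists>i\<in>int_partitions n. matrix_rep n i M"
    using matrix_rep_profile_matrices[OF assms(2)] by blast
  then show "represented M \<in> BP n"
    using matrix_rep_represented by blast
next
  fix c assume "c \<in> BP_star n"
  then obtain \<mu> where \<mu>: "\<mu> \<in> BP n" "c = BP_iso n `` {\<mu>}"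
    unfolding BP_star_def by (rule quotientE)
  \<comment> \<open>Since the enumeration is the \<open>mset_set\<close> of \<open>X\<close>,
    counting outputs in the class with multiplicity is counting elements of
    \<open>X\<close>.\<close>
  obtain X where X: "finite X" "EnumBPiso lst n = mset_set X"
    using enumerates_EnumBPiso[OF assms(2), of n] by (auto simp: enumerates_def)
  obtain M where M: "M \<in> X" "(\<mu>, represented M) \<in> BP_iso n"
    and unique: "\<And>M'. M' \<in> X \<Longrightarrow> (\<mu>, represented M') \<in> BP_iso n \<Longrightarrow> M' = M"
    using ex1_profile_matrices[OF assms(2) \<mu>(1)] X by auto
  have "{M' \<in> X. (\<mu>, represented M') \<in> BP_iso n} = {M}"
    using M unique by blast
  then have "{M \<in> X. represented M \<in> c} = {M}"
    unfolding \<mu>(2) Image_singleton_iff .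
  then show "size {#M \<in># EnumBPiso lst n. represented M \<in> c#} = 1"
    using X by simp
qed

end
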